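(* Let $V$ and the minimum energy path $M$ satisfy the standing assumptions in the context. Then $M$ is uniformly stable in the Hausdorff distance under the gradient descent dynamics on curves. Moreover, there is a compact set $B\subset\mathbb R^d$ containing an open neighborhood of $M$ such that $M$ is asymptotically stable on $B$ with uniform convergence.
   Context: **Setting.** $|\cdot|$ is the Euclidean norm on $\mathbb R^d$. The potential $V:\mathbb R^d\to\mathbb R$ is three times continuously differentiable, $\nabla V$ is globally Lipschitz with constant $L>0$, and there is $C_3>0$ bounding $|\partial^3 V/\partial x_i\partial x_j\partial x_l(x)|$ for all $x$ and all $i,j,l$. $S_t$ ($t\ge0$) denotes the flow of $\dot x=-\nabla V(x)$. The gradient descent dynamics on curves evolves a curve $\Gamma_0$ by $\Gamma_t=S_t(\Gamma_0)$ (image of the set). **Minimum energy path.** A curve is the image of a continuous path $[a,b]\to\mathbb R^d$. A minimum energy path connecting local minima $m,m'$ of $V$ is (the image of) a path $\phi:[a,b]\to\mathbb R^d$ with $\phi(a)=m$, $\phi(b)=m'$ and $\nabla V(\phi)-\langle\nabla V(\phi),\phi'/\|\phi'\|\rangle\,\phi'/\|\phi'\|=0$ at every $\alpha\in[a,b]$ for which $\phi(\alpha)$ is not a critical point of $V$; kinks are allowed at critical points. Thus it consists of critical points and heteroclinic trajectories of the gradient flow. **Standing assumptions on $M$.** $M$ is a fixed minimum energy path from the local minimum $m_1$ to the local minimum $m_k$, passing in order through $m_1,s_1,m_2,s_2,\dots,s_{k-1},m_k$, where the $m_i$ are local minima and the $s_i$ are saddles; between consecutive critical points it follows a single heteroclinic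 trajectory, descending from $s_i$ to $m_i$ and from $s_i$ to $m_{i+1}$. These critical points are distinct and isolated, and no other critical points lie on $M$. Each $D^2V(s_i)$ has exactly one negative eigenvalue and all its other eigenvalues are positive; each $D^2V(m_i)$ is positive definite. $M$ does not intersect itself, so it is homeomorphic to an interval. **Hausdorff distance.** For compact $X,Y$, $d(X,Y)=\sup_{x\in X}\inf_{y\in Y}|x-y|$ and $d_H(X,Y)=\max\{d(X,Y),d(Y,X)\}$. **Curves.** $\mathbf C(m_1,m_k)$ is the set of all continuous curves connecting $m_1$ and $m_k$; $\mathbf C(m_1,m_k,B)$ is the set of those contained in $B$. **Uniform stability.** $M$ is uniformly stable in Hausdorff distance if for every $\varepsilon>0$ there is $\delta>0$ such that for all $\phi\in\mathbf C(m_1,m_k)$, $d_H(M,\phi)\le\delta$ implies $d_H(M,S_t\phi)\le\varepsilon$ for all $t\ge0$. **Asymptotic stability with uniform convergence.** For compact $B$ with $M\subset B\subset\mathbb R^d$, $M$ is asymptotically stable on $B$ with uniform convergence if for every $\varepsilon>0$ there is a time $T(\varepsilon,B)$ such that for all $\phi\in\mathbf C(m_1,m_k,B)$, $d_H(M,S_t\phi)<\varepsilon$ for all $t>T(\varepsilon,B)$. *)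

theory Defs
  imports "HOL-Analysis.Analysis"
begin

definition partial_deriv :: "'n \<Rightarrow> (real^'n \<Rightarrow> real) \<Rightarrow> real^'n \<Rightarrow> real" where
  "partial_deriv i f x = frechet_derivative f (at x) (axis i 1)"

fun times_continuously_differentiable :: "nat \<Rightarrow> (real^'n \<Rightarrow> real) \<Rightarrow> bool" where
  "times_continuously_differentiable 0 f \<longleftrightarrow> continuous_on UNIV f"
| "times_continuously_differentiable (Suc k) f \<longleftrightarrow>
     (\<forall>x. f differentiable (at x)) \<and>
     (\<forall>i. times_continuously_differentiable k (partial_deriv i f))"

definition grad :: "(real^'n \<Rightarrow> real) \<Rightarrow> real^'n \<Rightarrow> real^'n" where
  "grad V x = (\<chi> i. partial_deriv i V x)"

definition hessian :: "(real^'n \<Rightarrow> real) \<Rightarrow> real^'n \<Rightarrow> real^'n^'n" where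
  "hessian V x = (\<chi> i j. partial_deriv i (partial_deriv j V) x)"

definition critical_points :: "(real^'n \<Rightarrow> real) \<Rightarrow> (real^'n) set" where
  "critical_points V = {x. grad V x = 0}"

definition local_minimum :: "(real^'n \<Rightarrow> real) \<Rightarrow> real^'n \<Rightarrow> bool" where
  "local_minimum V x \<longleftrightarrow> (\<forall>\<^sub>F y in nhds x. V x \<le> V y)"

definition positive_definite :: "real^'n^'n \<Rightarrow> bool" where
  "positive_definite A \<longleftrightarrow> (\<forall>v. v \<noteq> 0 \<longrightarrow> v \<bullet> (A *v v) > 0)"

definition eigenspace :: "real^'n^'n \<Rightarrow> real \<Rightarrow> (real^'n) set" where
  "eigenspace A l = {v. A *v v = l *\<^sub>R v}"

definition eigenvalue :: "real^'n^'n \<Rightarrow> real \<Rightarrow> bool" where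
  "eigenvalue A l \<longleftrightarrow> (\<exists>v. v \<noteq> 0 \<and> v \<in> eigenspace A l)"

text \<open>Eigenvalues are counted with multiplicity, so the negative eigenvalue is required to be
  simple.  The definition is used for Hessians of functions that are twice continuously
  differentiable; these are symmetric, so the multiplicity is the dimension of the eigenspace.\<close>

definition one_negative_others_positive :: "real^'n^'n \<Rightarrow> bool" where
  "one_negative_others_positive A \<longleftrightarrow>
     (\<exists>l<0. eigenvalue A l \<and> dim (eigenspace A l) = 1 \<and>
            (\<forall>\<mu>. eigenvalue A \<mu> \<and> \<mu> \<noteq> l \<longrightarrow> \<mu> > 0))"

text \<open>A saddle is a critical point of index one, all other directions being nondegenerate.  (In
  dimension one this is a nondegenerate local maximum, the barrier between two minima.)\<close>

definition saddle :: "(real^'n \<Rightarrow> real) \<Rightarrow> real^'n \<Rightarrow> bool" where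
  "saddle V x \<longleftrightarrow> x \<in> critical_points V \<and> one_negative_others_positive (hessian V x)"

text \<open>The flow is considered for times \<open>t \<ge> 0\<close> only; when the gradient is Lipschitz these
  conditions determine \<open>S t\<close> uniquely for every \<open>t \<ge> 0\<close>.\<close>

definition gradient_flow :: "(real^'n \<Rightarrow> real) \<Rightarrow> (real \<Rightarrow> real^'n \<Rightarrow> real^'n) \<Rightarrow> bool" where
  "gradient_flow V S \<longleftrightarrow>
     (\<forall>x. S 0 x = x \<and>
        (\<forall>t\<ge>0. ((\<lambda>t. S t x) has_vector_derivative - grad V (S t x)) (at t within {0..})))"

definition heteroclinic_trajectory ::
  "(real^'n \<Rightarrow> real) \<Rightarrow> real^'n \<Rightarrow> real^'n \<Rightarrow> (real^'n) set \<Rightarrow> bool" where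
  "heteroclinic_trajectory V p q \<Gamma> \<longleftrightarrow>
     (\<exists>\<gamma>. (\<forall>t. (\<gamma> has_vector_derivative - grad V (\<gamma> t)) (at t)) \<and>
          (\<gamma> \<longlongrightarrow> p) at_bot \<and> (\<gamma> \<longlongrightarrow> q) at_top \<and> \<Gamma> = range \<gamma>)"

text \<open>Kinks are allowed at critical points only: everywhere else the path has a nonzero tangent
  vector, and the component of the gradient normal to it vanishes.\<close>

definition minimum_energy_path ::
  "(real^'n \<Rightarrow> real) \<Rightarrow> real^'n \<Rightarrow> real^'n \<Rightarrow> real \<Rightarrow> real \<Rightarrow> (real \<Rightarrow> real^'n) \<Rightarrow> bool" where
  "minimum_energy_path V p q a b \<phi> \<longleftrightarrow>
     local_minimum V p \<and> local_minimum V q \<and>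
     a < b \<and> continuous_on {a..b} \<phi> \<and> \<phi> a = p \<and> \<phi> b = q \<and>
     (\<forall>\<alpha>\<in>{a..b}. \<phi> \<alpha> \<notin> critical_points V \<longrightarrow>
        (\<exists>v. v \<noteq> 0 \<and> (\<phi> has_vector_derivative v) (at \<alpha> within {a..b}) \<and>
             grad V (\<phi> \<alpha>) - (grad V (\<phi> \<alpha>) \<bullet> (v /\<^sub>R norm v)) *\<^sub>R (v /\<^sub>R norm v) = 0))"

text \<open>The parametrization \<open>\<phi>\<close> of \<open>M\<close> on \<open>[a, b]\<close> visits the minimum \<open>m i\<close> at the parameter
  \<open>\<tau> i\<close> and the saddle \<open>s i\<close> at \<open>\<sigma> i\<close>; the minima are \<open>m 1, \<dots>, m k\<close> and the saddles
  \<open>s 1, \<dots>, s (k - 1)\<close>.  That \<open>M\<close> does not intersect itself is expressed by choosing \<open>\<phi>\<close> injective.\<close>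

definition passes_in_order ::
  "(real^'n \<Rightarrow> real) \<Rightarrow> real \<Rightarrow> real \<Rightarrow> (real \<Rightarrow> real^'n) \<Rightarrow> nat \<Rightarrow>
   (nat \<Rightarrow> real^'n) \<Rightarrow> (nat \<Rightarrow> real^'n) \<Rightarrow> bool" where
  "passes_in_order V a b \<phi> k m s \<longleftrightarrow>
     (\<exists>\<tau> \<sigma>. \<tau> 1 = a \<and> \<tau> k = b \<and>
        (\<forall>i\<in>{1..k}. \<phi> (\<tau> i) = m i) \<and>
        (\<forall>i\<in>{1..<k}. \<phi> (\<sigma> i) = s i \<and> \<tau> i < \<sigma> i \<and> \<sigma> i < \<tau> (Suc i) \<and>
           heteroclinic_trajectory V (s i) (m i) (\<phi> ` {\<tau> i<..<\<sigma> i}) \<and>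
           heteroclinic_trajectory V (s i) (m (Suc i)) (\<phi> ` {\<sigma> i<..<\<tau> (Suc i)})))"

text \<open>The one-sided distance and the Hausdorff distance are meant for nonempty compact sets, for
  which all the suprema and infima over reals below exist.\<close>

definition one_sided_dist :: "(real^'n) set \<Rightarrow> (real^'n) set \<Rightarrow> real" where
  "one_sided_dist X Y = (SUP x\<in>X. INF y\<in>Y. norm (x - y))"

definition hausdorff_dist :: "(real^'n) set \<Rightarrow> (real^'n) set \<Rightarrow> real" where
  "hausdorff_dist X Y = max (one_sided_dist X Y) (one_sided_dist Y X)"

definition curves :: "real^'n \<Rightarrow> real^'n \<Rightarrow> (real^'n) set set" where
  "curves p q = {path_image g | g. path g \<and> pathstart g = p \<and> pathfinish g = q}"

definition curves_in :: "real^'n \<Rightarrow> real^'n \<Rightarrow> (real^'n) set \<Rightarrow> (real^'n) set set" where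
  "curves_in p q B = {\<Gamma> \<in> curves p q. \<Gamma> \<subseteq> B}"

definition uniformly_stable ::
  "(real \<Rightarrow> real^'n \<Rightarrow> real^'n) \<Rightarrow> real^'n \<Rightarrow> real^'n \<Rightarrow> (real^'n) set \<Rightarrow> bool" where
  "uniformly_stable S p q M \<longleftrightarrow>
     (\<forall>\<epsilon>>0. \<exists>\<delta>>0. \<forall>\<Gamma>\<in>curves p q. hausdorff_dist M \<Gamma> \<le> \<delta> \<longrightarrow>
        (\<forall>t\<ge>0. hausdorff_dist M (S t ` \<Gamma>) \<le> \<epsilon>))"

definition asymptotically_stable_on ::
  "(real \<Rightarrow> real^'n \<Rightarrow> real^'n) \<Rightarrow> real^'n \<Rightarrow> real^'n \<Rightarrow> (real^'n) set \<Rightarrow> (real^'n) set \<Rightarrow> bool" where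
  "asymptotically_stable_on S p q M B \<longleftrightarrow>
     compact B \<and> M \<subseteq> B \<and>
     (\<forall>\<epsilon>>0. \<exists>T\<ge>0. \<forall>\<Gamma>\<in>curves_in p q B. \<forall>t>T. hausdorff_dist M (S t ` \<Gamma>) < \<epsilon>)"

end

theory Submission
  imports Defs
begin

text \<open>Closeness of \<open>S t ` \<Gamma>\<close> to \<open>M\<close> in the sense that every point of \<open>S t ` \<Gamma>\<close> is near \<open>M\<close> is
  stability of the compact invariant set \<open>M\<close> under the flow of points; the converse closeness is
  topological, since a connected set that joins the ends of an arc inside a thin neighbourhood of the
  arc cannot skip any part of it.

  For the stability of points, let \<open>N\<close> be a compact neighbourhood of \<open>M\<close> without further critical
  points.  A backward orbit in \<open>N\<close> must eventually stay near one critical point \<open>c\<close>, because \<open>V\<close>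
  increases along it.  Near \<open>c\<close>, with \<open>H\<close> the nondegenerate Hessian, the form \<open>d \<bullet> H d\<close> strictly
  decreases along the difference \<open>d\<close> of two orbits, so two local backward orbits with
  \<open>d \<bullet> H d \<ge> 0\<close> coincide.  At a minimum only the constant orbit remains; at a saddle the coordinate
  along the unstable direction is injective on local backward orbits, and the two heteroclinic
  trajectories in \<open>M\<close> already take all its values.  Hence every backward orbit in \<open>N\<close> lies in \<open>M\<close>,
  and compactness turns this into uniform attraction.  This replaces the unstable manifold theorem.\<close>

subsection \<open>Flow of a Lipschitz gradient\<close>

text \<open>The flow is differentiable only within \<open>{0..}\<close>. Inside the half-line this
  is an ordinary derivative, and at the ends of \<open>{p..q}\<close> continuity suffices, so that
  \<open>p = 0\<close> is allowed.\<close>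

lemma halfline_nonincreasing:
  fixes f f' :: "real \<Rightarrow> real"
  assumes f: "\<And>t. t \<ge> 0 \<Longrightarrow> (f has_real_derivative f' t) (at t within {0..})"
    and f': "\<And>t. p < t \<Longrightarrow> t < q \<Longrightarrow> f' t \<le> 0"
    and pq: "0 \<le> p" "p \<le> q"
  shows "f q \<le> f p"
proof (rule DERIV_nonpos_imp_decreasing_open[OF pq(2)])
  fix t assume t: "p < t" "t < q"
  then have "t \<in> interior {0..}" using pq by simp
  then show "\<exists>y. DERIV f t :> y \<and> y \<le> 0"
    using f[of t] f'[OF t] t pq at_within_interior[of t "{0..}"] by auto
next
  have "continuous_on {0..} f"
    using f by (intro DERIV_continuous_on) auto
  then show "continuous_on {p..q} f"
    by (rule continuous_on_subset) (use pq in auto)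
qed

text \<open>Dynamics with an abstract gradient \<open>G\<close>: only first derivatives of
  \<open>V\<close> occur, and second-order information enters \<open>backward_orbits_eq\<close> as a
  linear approximation of \<open>G\<close>.\<close>

locale lipschitz_gradient_flow =
  fixes V :: "'a::euclidean_space \<Rightarrow> real" and G :: "'a \<Rightarrow> 'a" and L :: real
    and S :: "real \<Rightarrow> 'a \<Rightarrow> 'a"
  assumes V_deriv: "\<And>x. (V has_derivative (\<lambda>h. G x \<bullet> h)) (at x)"
    and lip: "L-lipschitz_on UNIV G"
    and flow_0 [simp]: "\<And>x. S 0 x = x"
    and flow_deriv: "\<And>t x. t \<ge> 0 \<Longrightarrow>
      ((\<lambda>t. S t x) has_vector_derivative - G (S t x)) (at t within {0..})"
begin

definition solution :: "(real \<Rightarrow> 'a) \<Rightarrow> bool" where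
  "solution x \<longleftrightarrow> (\<forall>t\<ge>0. (x has_vector_derivative - G (x t)) (at t within {0..}))"

lemma solution_flow: "solution (\<lambda>t. S t x)"
  by (simp add: solution_def flow_deriv)

lemma L_nonneg: "L \<ge> 0"
  using lip by (rule lipschitz_on_nonneg)

lemma lip_norm: "norm (G x - G y) \<le> L * norm (x - y)"
  using lipschitz_onD[OF lip, of x y] by (simp add: dist_norm)

lemma solution_shift:
  assumes "solution x" "h \<ge> 0"
  shows "solution (\<lambda>t. x (t + h))"
  unfolding solution_def
proof safe
  fix t :: real assume t: "t \<ge> 0"
  have "(x has_vector_derivative - G (x (t + h))) (at (t + h) within {0..})"
    using assms t by (simp add: solution_def)
  then have "(x has_vector_derivative - G (x (t + h))) (at (t + h) within (\<lambda>t. t + h) ` {0..})"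
    by (rule has_vector_derivative_within_subset) (use assms(2) in auto)
  moreover have "((\<lambda>t. t + h) has_vector_derivative 1) (at t within {0..})"
    by (auto intro!: derivative_eq_intros)
  ultimately have "((x \<circ> (\<lambda>t. t + h)) has_vector_derivative 1 *\<^sub>R - G (x (t + h))) (at t within {0..})"
    by (intro vector_diff_chain_within)
  then show "((\<lambda>t. x (t + h)) has_vector_derivative - G (x (t + h))) (at t within {0..})"
    by (simp add: o_def)
qed

lemma solution_dist_sq_deriv:
  assumes "solution x" "solution y" "t \<ge> 0"
  shows "((\<lambda>t. (norm (x t - y t))\<^sup>2) has_real_derivative
    - 2 * ((x t - y t) \<bullet> (G (x t) - G (y t)))) (at t within {0..})"
proof -
  have "((\<lambda>t. x t - y t) has_derivative (\<lambda>h. h *\<^sub>R (- G (x t) - - G (y t)))) (at t within {0..})"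
    using assms has_vector_derivative_diff[of x _ _ y]
    unfolding solution_def has_vector_derivative_def[symmetric] by blast
  from has_derivative_inner[OF this this] show ?thesis
    unfolding has_field_derivative_def power2_norm_eq_inner
    by (rule has_derivative_eq_rhs) (auto simp: fun_eq_iff inner_simps inner_commute algebra_simps)
qed

lemma inner_lip: "\<bar>d \<bullet> (G x - G y)\<bar> \<le> L * norm d * norm (x - y)"
proof -
  have "\<bar>d \<bullet> (G x - G y)\<bar> \<le> norm d * norm (G x - G y)" by (rule Cauchy_Schwarz_ineq2)
  also have "\<dots> \<le> norm d * (L * norm (x - y))" by (intro mult_left_mono lip_norm) auto
  finally show ?thesis by (simp add: mult_ac)
qed

text \<open>Gronwall's estimate in both time directions: \<open>|x - y|^2\<close> decreases with the
  weight \<open>exp (- 2 L t)\<close> and increases with the weight \<open>exp (2 L t)\<close>. The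
  second bound makes the time maps injective, in place of a flow for negative times.\<close>

lemma solution_dist_exp:
  assumes x: "solution x" and y: "solution y" and t: "t \<ge> 0"
  shows "norm (x t - y t) \<le> exp (L * t) * norm (x 0 - y 0)" (is ?A)
    and "norm (x 0 - y 0) \<le> exp (L * t) * norm (x t - y t)" (is ?B)
proof -
  let ?f = "\<lambda>t. (norm (x t - y t))\<^sup>2"
  let ?f' = "\<lambda>t. - 2 * ((x t - y t) \<bullet> (G (x t) - G (y t)))"
  have b: "\<bar>?f' t\<bar> \<le> 2 * L * ?f t" for t
    using inner_lip[of "x t - y t" "x t" "y t"] by (simp add: power2_eq_square mult_ac abs_mult)
  have d: "((\<lambda>t. exp (c * t) * ?f t) has_real_derivative exp (c * t) * (c * ?f t + ?f' t))
      (at t within {0..})" if "t \<ge> 0" for t c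
  proof -
    have "((\<lambda>t. exp (c * t)) has_real_derivative exp (c * t) * c) (at t within {0..})"
      by (auto intro!: derivative_eq_intros)
    from DERIV_mult[OF this solution_dist_sq_deriv[OF x y that]] show ?thesis
      by (rule DERIV_cong) (simp only: distrib_left mult_ac)
  qed
  have "exp (- 2 * L * t) * ?f t \<le> exp (- 2 * L * 0) * ?f 0"
    by (rule halfline_nonincreasing[OF d _ order_refl t])
      (use b in \<open>auto simp: mult_le_0_iff abs_le_iff minus_le_iff\<close>)
  then have "?f t \<le> exp (2 * L * t) * ?f 0"
    by (simp add: exp_minus field_simps)
  also have "\<dots> = (exp (L * t) * norm (x 0 - y 0))\<^sup>2"
    by (simp add: power_mult_distrib exp_of_nat_mult[symmetric] mult.assoc)
  finally show ?A by (rule power2_le_imp_le) simp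
  have "- (exp (2 * L * t) * ?f t) \<le> - (exp (2 * L * 0) * ?f 0)"
    by (rule halfline_nonincreasing[OF DERIV_minus[OF d] _ order_refl t])
      (use b in \<open>auto simp: zero_le_mult_iff abs_le_iff minus_le_iff\<close>)
  then have "?f 0 \<le> exp (2 * L * t) * ?f t" by simp
  also have "\<dots> = (exp (L * t) * norm (x t - y t))\<^sup>2"
    by (simp add: power_mult_distrib exp_of_nat_mult[symmetric] mult.assoc)
  finally show ?B by (rule power2_le_imp_le) simp
qed

lemma solution_eq_flow: "solution x \<Longrightarrow> t \<ge> 0 \<Longrightarrow> x t = S t (x 0)"
  using solution_dist_exp(1)[OF _ solution_flow, of x t "x 0"] by simp

lemma flow_add: "s \<ge> 0 \<Longrightarrow> t \<ge> 0 \<Longrightarrow> S (s + t) x = S s (S t x)"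
  using solution_eq_flow[OF solution_shift[OF solution_flow[of x], of t], of s] by simp

lemma flow_dist_le: "t \<ge> 0 \<Longrightarrow> norm (S t x - S t y) \<le> exp (L * t) * norm (x - y)"
  and flow_dist_ge: "t \<ge> 0 \<Longrightarrow> norm (x - y) \<le> exp (L * t) * norm (S t x - S t y)"
  using solution_dist_exp[OF solution_flow[of x] solution_flow[of y], of t] by simp_all

lemma flow_inj: "t \<ge> 0 \<Longrightarrow> S t x = S t y \<Longrightarrow> x = y"
  using flow_dist_ge[of t x y] by simp

lemma continuous_on_flow: "t \<ge> 0 \<Longrightarrow> continuous_on A (S t)"
  by (rule lipschitz_on_continuous_on[of "exp (L * t)"])
    (auto simp: lipschitz_on_def dist_norm flow_dist_le)

lemma continuous_on_flow_time: "continuous_on {0..} (\<lambda>t. S t x)"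
  using flow_deriv by (auto simp: continuous_on_eq_continuous_within
      intro: has_vector_derivative_continuous)

lemma flow_critical: "G x = 0 \<Longrightarrow> t \<ge> 0 \<Longrightarrow> S t x = x"
  using solution_eq_flow[of "\<lambda>_. x" t] by (simp add: solution_def)

lemma V_flow_deriv:
  assumes "t \<ge> 0"
  shows "((\<lambda>t. V (S t x)) has_real_derivative - (norm (G (S t x)))\<^sup>2) (at t within {0..})"
proof -
  have "((\<lambda>t. V (S t x)) has_derivative (\<lambda>h. G (S t x) \<bullet> (h *\<^sub>R (- G (S t x))))) (at t within {0..})"
    using diff_chain_within[of "\<lambda>t. S t x", unfolded o_def,
      OF flow_deriv[OF assms, unfolded has_vector_derivative_def]
      has_derivative_at_withinI[OF V_deriv]] .
  then show ?thesis
    unfolding has_field_derivative_def power2_norm_eq_inner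
    by (rule has_derivative_eq_rhs) (auto simp: fun_eq_iff)
qed

lemma V_flow_antimono: "0 \<le> s \<Longrightarrow> s \<le> t \<Longrightarrow> V (S t x) \<le> V (S s x)"
  by (rule halfline_nonincreasing[OF V_flow_deriv]) auto

text \<open>Monotonicity of \<open>V\<close> along the orbit squeezes it to a constant on
  \<open>{0..1}\<close>; its one-sided derivative at 0, which is \<open>- |G x|^2\<close>, therefore
  vanishes.\<close>

lemma critical_if_V_constant:
  assumes "V (S 1 x) = V x"
  shows "G x = 0"
proof -
  have c: "V (S t x) = V x" if "t \<in> {0..1}" for t
    using V_flow_antimono[of 0 t x] V_flow_antimono[of t 1 x] assms that by simp
  have 1: "((\<lambda>t. V (S t x)) has_real_derivative - (norm (G x))\<^sup>2) (at 0 within {0..1})"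
    using DERIV_subset[OF V_flow_deriv[of 0 x], of "{0..1}"] by simp
  have "((\<lambda>t. V (S t x)) has_real_derivative 0) (at 0 within {0..1})"
    by (rule has_field_derivative_transform_within[OF DERIV_const[of "V x"], of 1]) (auto simp: c)
  with 1 have "- (norm (G x))\<^sup>2 = 0"
    unfolding has_real_derivative_iff_has_vector_derivative
    by (rule vector_derivative_unique_within[rotated]) (simp add: trivial_limit_within islimpt_Icc)
  then show ?thesis by simp
qed

text \<open>The argument of \<open>\<gamma>\<close> is the time elapsed into the past, so
  \<open>\<gamma> 0\<close> is the present point. The past is described by forward maps because
  \<open>S\<close> is constrained for nonnegative times only; values of \<open>\<gamma>\<close> at
  negative arguments are arbitrary.\<close>

definition backward_orbit :: "(real \<Rightarrow> 'a) \<Rightarrow> bool" where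
  "backward_orbit \<gamma> \<longleftrightarrow> (\<forall>T\<ge>0. \<forall>h\<in>{0..T}. S h (\<gamma> T) = \<gamma> (T - h))"

lemma backward_orbitD: "backward_orbit \<gamma> \<Longrightarrow> 0 \<le> h \<Longrightarrow> h \<le> T \<Longrightarrow> S h (\<gamma> T) = \<gamma> (T - h)"
  by (auto simp: backward_orbit_def)

lemma backward_orbit_shift:
  assumes "backward_orbit \<gamma>" "T0 \<ge> 0"
  shows "backward_orbit (\<lambda>T. \<gamma> (T + T0))"
  unfolding backward_orbit_def
proof safe
  fix T h :: real assume "h \<in> {0..T}"
  then show "S h (\<gamma> (T + T0)) = \<gamma> (T - h + T0)"
    using backward_orbitD[OF assms(1), of h "T + T0"] assms(2) by (simp add: add_diff_eq diff_add_eq)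
qed

lemma backward_orbit_critical: "G c = 0 \<Longrightarrow> backward_orbit (\<lambda>_. c)"
  by (simp add: backward_orbit_def flow_critical)

lemma backward_orbit_entire_solution:
  assumes "\<And>t. (g has_vector_derivative - G (g t)) (at t)"
  shows "backward_orbit (\<lambda>T. g (t0 - T))"
  unfolding backward_orbit_def
proof safe
  fix T h :: real assume "h \<in> {0..T}" "T \<ge> 0"
  have "solution (\<lambda>h. g (h + (t0 - T)))"
    unfolding solution_def
  proof safe
    fix t :: real
    have "((\<lambda>h. h + (t0 - T)) has_vector_derivative 1) (at t within {0..})"
      by (auto intro!: derivative_eq_intros)
    from vector_diff_chain_within[OF this has_vector_derivative_at_within[OF assms]]
    show "((\<lambda>h. g (h + (t0 - T))) has_vector_derivative - G (g (t + (t0 - T)))) (at t within {0..})"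
      by (simp add: o_def)
  qed
  from solution_eq_flow[OF this, of h] \<open>h \<in> _\<close> show "S h (g (t0 - T)) = g (t0 - (T - h))"
    by (simp add: algebra_simps)
qed

lemma flow_entire_solution:
  assumes "\<And>t. (g has_vector_derivative - G (g t)) (at t)" "h \<ge> 0"
  shows "S h (g t) = g (t + h)"
  using backward_orbitD[OF backward_orbit_entire_solution[OF assms(1), of "t + h"], of h h] assms(2)
  by simp

text \<open>On \<open>{0..T}\<close> the path is the forward orbit of \<open>\<gamma> T\<close> run
  in reverse.\<close>

lemma continuous_on_backward_orbit:
  assumes "backward_orbit \<gamma>"
  shows "continuous_on {0..T} \<gamma>"
proof -
  have "continuous_on {0..T} (\<lambda>t. S (T - t) (\<gamma> T))"
    by (intro continuous_on_compose2[OF continuous_on_flow_time]) (auto intro!: continuous_intros)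
  then show ?thesis
    by (rule continuous_on_eq) (use backward_orbitD[OF assms] in auto)
qed

end

subsection \<open>Backward orbits near an invariant set\<close>

lemma compact_infdist_subset_open:
  fixes M :: "'a::heine_borel set"
  assumes "compact M" "M \<noteq> {}" "open U" "M \<subseteq> U"
  obtains d where "d > 0" "\<And>x. infdist x M \<le> d \<Longrightarrow> x \<in> U"
proof -
  have "closed (- U)" "M \<inter> - U = {}" using assms by auto
  from separate_compact_closed[OF assms(1) this]
  obtain d where d: "d > 0" "\<And>x y. x \<in> M \<Longrightarrow> y \<in> - U \<Longrightarrow> d \<le> dist x y" by metis
  \<comment> \<open>Halving \<open>d\<close> makes the non-strict bound safe: a point of
    \<open>- U\<close> may have distance exactly \<open>d\<close> from \<open>M\<close>.\<close>
  have "x \<in> U" if "infdist x M \<le> d / 2" for x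
  proof -
    obtain y where "y \<in> M" "infdist x M = dist x y"
      using infdist_attains_inf[OF compact_imp_closed assms(2)] assms(1) by metis
    with d(1) d(2)[of y x] that show ?thesis by (force simp: dist_commute)
  qed
  with d(1) show thesis by (intro that[of "d / 2"]) auto
qed

lemma finite_separated:
  fixes C :: "'a::metric_space set"
  assumes "finite C"
  obtains d where "d > 0" "\<And>x y. x \<in> C \<Longrightarrow> y \<in> C \<Longrightarrow> x \<noteq> y \<Longrightarrow> d \<le> dist x y"
proof -
  \<comment> \<open>The 1 keeps the set nonempty when \<open>C\<close> has at most one
    point.\<close>
  let ?D = "insert 1 ((\<lambda>(x, y). dist x y) ` {(x, y). x \<in> C \<and> y \<in> C \<and> x \<noteq> y})"
  have "finite {(x, y). x \<in> C \<and> y \<in> C \<and> x \<noteq> y}"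
    by (rule finite_subset[of _ "C \<times> C"]) (use assms in auto)
  then have fin: "finite ?D" by simp
  show thesis
  proof (rule that[of "Min ?D"])
    show "Min ?D > 0" using fin by (subst Min_gr_iff) auto
    show "Min ?D \<le> dist x y" if "x \<in> C" "y \<in> C" "x \<noteq> y" for x y
      using fin that by (intro Min_le) auto
  qed
qed

context lipschitz_gradient_flow
begin

lemma infdist_flow_le:
  assumes M: "compact M" "M \<noteq> {}" "\<And>x. x \<in> M \<Longrightarrow> S t x \<in> M" and t: "t \<ge> 0"
  shows "infdist (S t x) M \<le> exp (L * t) * infdist x M"
proof -
  obtain y where y: "y \<in> M" "infdist x M = dist x y"
    using infdist_attains_inf[OF compact_imp_closed M(2)] M(1) by metis
  have "infdist (S t x) M \<le> dist (S t x) (S t y)"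
    using M(3)[OF y(1)] by (rule infdist_le)
  also have "\<dots> \<le> exp (L * t) * dist x y"
    using flow_dist_le[OF t] by (simp add: dist_norm)
  finally show ?thesis using y by simp
qed

text \<open>Along the flow the difference \<open>d\<close> satisfies \<open>d' = - A d\<close> up to a small remainder, so
  \<open>d \<bullet> A d\<close> decreases at a rate of order \<open>|A d|\<^sup>2\<close>.  The extra term \<open>\<beta> |d|\<^sup>2\<close> in \<open>Q\<close> keeps \<open>Q\<close>
  bounded away from 0; then \<open>Q\<close> grows linearly in backward time, although \<open>d\<close> is bounded.\<close>

lemma backward_orbits_eq:
  assumes A: "bounded_linear A" and sym: "\<And>x y. A x \<bullet> y = x \<bullet> A y"
    and k: "k > 0" "\<And>v. k * norm v \<le> norm (A v)"
    and r: "\<And>x y. x \<in> cball c r \<Longrightarrow> y \<in> cball c r \<Longrightarrow>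
      norm (G x - G y - A (x - y)) \<le> k / 2 * norm (x - y)"
    and orb: "backward_orbit \<gamma>" "backward_orbit \<delta>"
    and ball: "\<And>T. T \<ge> 0 \<Longrightarrow> \<gamma> T \<in> cball c r" "\<And>T. T \<ge> 0 \<Longrightarrow> \<delta> T \<in> cball c r"
    and nonneg: "(\<gamma> 0 - \<delta> 0) \<bullet> A (\<gamma> 0 - \<delta> 0) \<ge> 0"
  shows "\<gamma> 0 = \<delta> 0"
proof -
  obtain K where K: "K > 0" "\<And>v. norm (A v) \<le> K * norm v"
    using bounded_linear.pos_bounded[OF A] by (auto simp: mult.commute)
  \<comment> \<open>\<open>\<beta>\<close> is so small that the term \<open>\<beta> |d|^2\<close>,
    whose derivative is at most \<open>2 \<beta> L |d|^2\<close>, uses up at most half of the decay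
    \<open>k^2 |d|^2\<close> of the form \<open>d \<bullet> A d\<close>. The summand 1 avoids
    division by zero when \<open>L = 0\<close>.\<close>
  define \<beta> where "\<beta> = k\<^sup>2 / (4 * (L + 1))"
  have \<beta>: "\<beta> > 0" "2 * \<beta> * L \<le> k\<^sup>2 / 2"
  proof -
    show "\<beta> > 0" using k(1) L_nonneg by (auto simp: \<beta>_def)
    have "2 * \<beta> * L = k\<^sup>2 / 2 * (L / (L + 1))"
      using L_nonneg by (simp add: \<beta>_def field_simps)
    also have "\<dots> \<le> k\<^sup>2 / 2 * 1"
      using L_nonneg by (intro mult_left_mono) auto
    finally show "2 * \<beta> * L \<le> k\<^sup>2 / 2" by simp
  qed
  define Q where "Q d = d \<bullet> A d + \<beta> * (norm d)\<^sup>2" for d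
  have Q_le: "Q d \<le> (K + \<beta>) * (norm d)\<^sup>2" for d
  proof -
    have "d \<bullet> A d \<le> norm d * norm (A d)" by (rule norm_cauchy_schwarz)
    also have "\<dots> \<le> norm d * (K * norm d)" by (intro mult_left_mono K) auto
    finally show ?thesis by (simp add: Q_def power2_eq_square algebra_simps)
  qed
  \<comment> \<open>\<open>\<mu>\<close> will bound \<open>|d|^2\<close> from below along the whole
    past: \<open>Q\<close> is at least \<open>\<beta> |\<gamma> 0 - \<delta> 0|^2\<close> at present
    by \<open>nonneg\<close>, is no smaller in the past, and is at most
    \<open>(K + \<beta>) |d|^2\<close>.\<close>
  define \<mu> where "\<mu> = \<beta> * (norm (\<gamma> 0 - \<delta> 0))\<^sup>2 / (K + \<beta>)"
  \<comment> \<open>Over a time \<open>T\<close> the quantity \<open>Q\<close> falls by at least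
    \<open>T * (k^2 / 2 * \<mu>)\<close> and ends nonnegative, while its initial value is limited by
    the diameter of the ball. As this limit does not depend on \<open>T\<close>,
    \<open>\<mu> > 0\<close> is impossible.\<close>
  have bound: "T * (k\<^sup>2 / 2 * \<mu>) \<le> (K + \<beta>) * (2 * r)\<^sup>2" if T: "T \<ge> 0" for T
  proof -
    \<comment> \<open>Time now runs forward from the points \<open>T\<close> in the past:
      \<open>d 0\<close> is the oldest difference and \<open>d T\<close> the present one.\<close>
    define d where "d t = S t (\<gamma> T) - S t (\<delta> T)" for t
    define g where "g t = G (S t (\<gamma> T)) - G (S t (\<delta> T))" for t
    have d_T: "d t = \<gamma> (T - t) - \<delta> (T - t)" if "0 \<le> t" "t \<le> T" for t
      using backward_orbitD[OF orb(1) that] backward_orbitD[OF orb(2) that] by (simp add: d_def)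
    define Q' where "Q' t = - 2 * (A (d t) \<bullet> g t) - 2 * \<beta> * (d t \<bullet> g t)" for t
    have Q_deriv: "((\<lambda>t. Q (d t)) has_real_derivative Q' t) (at t within {0..})" if "t \<ge> 0" for t
    proof -
      have "(d has_derivative (\<lambda>h. h *\<^sub>R (- G (S t (\<gamma> T)) - - G (S t (\<delta> T))))) (at t within {0..})"
        unfolding d_def using flow_deriv[OF that] unfolding has_vector_derivative_def[symmetric]
        by (intro has_vector_derivative_diff) auto
      then have d: "(d has_derivative (\<lambda>h. h *\<^sub>R (- g t))) (at t within {0..})"
        by (simp add: g_def)
      from has_derivative_inner[OF d bounded_linear.has_derivative[OF A d]]
      have 1: "((\<lambda>t. d t \<bullet> A (d t)) has_real_derivative - 2 * (A (d t) \<bullet> g t)) (at t within {0..})"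
        unfolding has_field_derivative_def
        by (rule has_derivative_eq_rhs)
          (auto simp: fun_eq_iff bounded_linear.linear[OF A] linear_cmul linear_neg sym[of "d t" "g t"]
            inner_commute[of "g t"])
      from has_derivative_inner[OF d d]
      have 2: "((\<lambda>t. (norm (d t))\<^sup>2) has_real_derivative - 2 * (d t \<bullet> g t)) (at t within {0..})"
        unfolding has_field_derivative_def power2_norm_eq_inner
        by (rule has_derivative_eq_rhs) (auto simp: fun_eq_iff inner_commute[of "g t"])
      show ?thesis
        using DERIV_add[OF 1 DERIV_cmult[OF 2, of \<beta>]] unfolding Q_def Q'_def
        by (rule DERIV_cong) simp
    qed
    have Q'_le: "Q' t \<le> - (k\<^sup>2 / 2) * (norm (d t))\<^sup>2" if t: "0 \<le> t" "t \<le> T" for t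
    proof -
      have "S t (\<gamma> T) \<in> cball c r" "S t (\<delta> T) \<in> cball c r"
        using backward_orbitD[OF orb(1) t] backward_orbitD[OF orb(2) t] ball t by auto
      from r[OF this] have "norm (g t - A (d t)) \<le> k / 2 * norm (d t)"
        by (simp add: g_def d_def)
      \<comment> \<open>The linearization error is at most half of \<open>|A d|\<close>, so
        Cauchy-Schwarz yields \<open>2 * (A d \<bullet> g) \<ge> |A d|^2\<close>.\<close>
      then have "norm (A (d t)) * norm (g t - A (d t)) \<le> norm (A (d t)) * (norm (A (d t)) / 2)"
        using k(2)[of "d t"] by (intro mult_left_mono) auto
      moreover have "- (A (d t) \<bullet> (g t - A (d t))) \<le> norm (A (d t)) * norm (g t - A (d t))"
        using Cauchy_Schwarz_ineq2[of "A (d t)" "g t - A (d t)"] by linarith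
      ultimately have "(norm (A (d t)))\<^sup>2 \<le> 2 * (A (d t) \<bullet> g t)"
        by (simp add: inner_diff_right power2_norm_eq_inner[symmetric] power2_eq_square)
      moreover have "(k * norm (d t))\<^sup>2 \<le> (norm (A (d t)))\<^sup>2"
        using k by (intro power_mono) auto
      moreover have "- (d t \<bullet> g t) \<le> L * (norm (d t))\<^sup>2"
        using inner_lip[of "d t" "S t (\<gamma> T)" "S t (\<delta> T)"]
        by (simp add: g_def d_def power2_eq_square mult_ac)
      then have "2 * \<beta> * - (d t \<bullet> g t) \<le> 2 * \<beta> * (L * (norm (d t))\<^sup>2)"
        using \<beta>(1) by (intro mult_left_mono) auto
      moreover have "2 * \<beta> * L * (norm (d t))\<^sup>2 \<le> k\<^sup>2 / 2 * (norm (d t))\<^sup>2"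
        using \<beta>(2) by (intro mult_right_mono) auto
      ultimately show ?thesis unfolding Q'_def power_mult_distrib mult_minus_right mult.assoc by linarith
    qed
    have \<mu>_le: "\<mu> \<le> (norm (d t))\<^sup>2" if t: "0 \<le> t" "t \<le> T" for t
    proof -
      have "\<beta> * (norm (\<gamma> 0 - \<delta> 0))\<^sup>2 \<le> Q (d T)"
        using nonneg d_T[of T] T by (simp add: Q_def)
      also have "\<dots> \<le> Q (d t)"
      proof (rule halfline_nonincreasing[OF Q_deriv _ t])
        fix u assume "t < u" "u < T"
        then have "Q' u \<le> - (k\<^sup>2 / 2) * (norm (d u))\<^sup>2" using t by (intro Q'_le) auto
        also have "\<dots> \<le> 0" by simp
        finally show "Q' u \<le> 0" .
      qed
      also have "\<dots> \<le> (K + \<beta>) * (norm (d t))\<^sup>2" by (rule Q_le)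
      finally show ?thesis using K(1) \<beta>(1) by (simp add: \<mu>_def field_simps)
    qed
    have "Q (d T) + k\<^sup>2 / 2 * \<mu> * T \<le> Q (d 0) + k\<^sup>2 / 2 * \<mu> * 0"
    proof (rule halfline_nonincreasing[of "\<lambda>t. Q (d t) + k\<^sup>2 / 2 * \<mu> * t" "\<lambda>t. Q' t + k\<^sup>2 / 2 * \<mu>"])
      show "((\<lambda>t. Q (d t) + k\<^sup>2 / 2 * \<mu> * t) has_real_derivative Q' t + k\<^sup>2 / 2 * \<mu>) (at t within {0..})"
        if "t \<ge> 0" for t
        by (rule DERIV_add[OF Q_deriv[OF that]]) (auto intro!: derivative_eq_intros)
      show "Q' t + k\<^sup>2 / 2 * \<mu> \<le> 0" if "0 < t" "t < T" for t
        using Q'_le[of t] mult_left_mono[OF \<mu>_le[of t], of "k\<^sup>2 / 2"] that by auto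
    qed (use T in auto)
    moreover have "Q (d T) \<ge> 0"
      using nonneg d_T[of T] T \<beta>(1) by (simp add: Q_def)
    moreover have "norm (d 0) \<le> 2 * r"
      using norm_triangle_ineq4[of "\<gamma> T - c" "\<delta> T - c"] ball[of T] T d_T[of 0]
      by (auto simp: dist_norm norm_minus_commute)
    then have "(norm (d 0))\<^sup>2 \<le> (2 * r)\<^sup>2" by (intro power_mono) auto
    then have "(K + \<beta>) * (norm (d 0))\<^sup>2 \<le> (K + \<beta>) * (2 * r)\<^sup>2"
      using K(1) \<beta>(1) by (intro mult_left_mono) auto
    ultimately show ?thesis using Q_le[of "d 0"] by (simp add: mult_ac)
  qed
  define \<kappa> where "\<kappa> = k\<^sup>2 / 2 * \<mu>"
  have "\<not> \<kappa> > 0"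
  proof
    assume pos: "\<kappa> > 0"
    let ?T = "((K + \<beta>) * (2 * r)\<^sup>2 + 1) / \<kappa>"
    have "?T \<ge> 0" using pos K(1) \<beta>(1) by (intro divide_nonneg_pos) auto
    from bound[OF this] have "?T * \<kappa> \<le> (K + \<beta>) * (2 * r)\<^sup>2" by (simp only: \<kappa>_def)
    moreover have "?T * \<kappa> = (K + \<beta>) * (2 * r)\<^sup>2 + 1" using pos by simp
    ultimately show False by linarith
  qed
  then have "\<mu> \<le> 0" using k(1) by (auto simp: \<kappa>_def zero_less_mult_iff)
  then show ?thesis
    using K(1) \<beta>(1) by (simp add: \<mu>_def divide_le_0_iff mult_le_0_iff)
qed

text \<open>A point of the orbit outside small balls around \<open>C\<close> accounts for a gain of
  at least a fixed \<open>e\<close> in \<open>V\<close> over one unit of backward time. Once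
  \<open>V\<close> is close to its supremum along the orbit this cannot happen any more. The balls
  are disjoint, so by connectedness the orbit then stays in one of them.\<close>

lemma backward_orbit_eventually_near_critical:
  assumes N: "compact N" and C: "finite C" "{x \<in> N. G x = 0} \<subseteq> C"
    and orb: "backward_orbit \<gamma>" "\<And>T. T \<ge> 0 \<Longrightarrow> \<gamma> T \<in> N" and r: "\<And>c. c \<in> C \<Longrightarrow> r c > 0"
  obtains c T where "c \<in> C" "T \<ge> 0" "\<And>t. t \<ge> T \<Longrightarrow> \<gamma> t \<in> cball c (r c)"
proof -
  obtain \<delta> where \<delta>: "\<delta> > 0" "\<And>x y. x \<in> C \<Longrightarrow> y \<in> C \<Longrightarrow> x \<noteq> y \<Longrightarrow> \<delta> \<le> dist x y"
    using finite_separated[OF C(1)] by metis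
  \<comment> \<open>Half the separation \<open>\<delta>\<close> makes the open balls around distinct
    points of \<open>C\<close> disjoint.\<close>
  define \<rho> where "\<rho> c = min (r c) (\<delta> / 2)" for c
  have \<rho>: "\<rho> c > 0" if "c \<in> C" for c using r[OF that] \<delta> by (simp add: \<rho>_def)
  have disj: "ball c (\<rho> c) \<inter> ball c' (\<rho> c') = {}" if "c \<in> C" "c' \<in> C" "c \<noteq> c'" for c c'
  proof -
    have "\<rho> c + \<rho> c' \<le> dist c c'" using \<delta>(2)[OF that] by (simp add: \<rho>_def)
    then show ?thesis by (metis disjoint_ballI)
  qed
  define N' where "N' = N - (\<Union>c\<in>C. ball c (\<rho> c))"
  have N': "compact N'" unfolding N'_def by (intro compact_diff N) auto
  have V_cont: "continuous_on A V" for A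
    using V_deriv by (intro continuous_at_imp_continuous_on) (auto intro: has_derivative_continuous)
  \<comment> \<open>On the compact remainder \<open>N'\<close> no critical point is left, so the
    continuous drop of \<open>V\<close> in unit time has a positive minimum there.\<close>
  have drop: "\<exists>e>0. \<forall>x\<in>N'. e \<le> V x - V (S 1 x)"
  proof (cases "N' = {}")
    case True
    then show ?thesis by (auto intro: exI[of _ 1])
  next
    case False
    have "continuous_on N' (\<lambda>x. V x - V (S 1 x))"
      by (intro continuous_intros V_cont continuous_on_compose2[OF V_cont[of UNIV] continuous_on_flow]) auto
    from continuous_attains_inf[OF N' False this]
    obtain x where x: "x \<in> N'" "\<And>y. y \<in> N' \<Longrightarrow> V x - V (S 1 x) \<le> V y - V (S 1 y)" by blast
    have "V x - V (S 1 x) > 0"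
    proof (rule ccontr)
      assume "\<not> V x - V (S 1 x) > 0"
      with V_flow_antimono[of 0 1 x] have "V (S 1 x) = V x" by simp
      then have "G x = 0" by (rule critical_if_V_constant)
      with x(1) C(2) have "x \<in> C" by (auto simp: N'_def)
      with x(1) \<rho> show False by (auto simp: N'_def)
    qed
    with x(2) show ?thesis by blast
  qed
  then obtain e where e: "e > 0" "\<And>x. x \<in> N' \<Longrightarrow> e \<le> V x - V (S 1 x)" by blast
  have mono: "V (\<gamma> s) \<le> V (\<gamma> t)" if "0 \<le> s" "s \<le> t" for s t
    using V_flow_antimono[of 0 "t - s" "\<gamma> t"] backward_orbitD[OF orb(1), of "t - s" t] that by simp
  have bdd: "bdd_above ((\<lambda>t. V (\<gamma> t)) ` {0..})"
  proof -
    have "bounded (V ` N)"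
      by (intro compact_imp_bounded compact_continuous_image V_cont N)
    then have "bdd_above (V ` N)" by (rule bounded_imp_bdd_above)
    then show ?thesis by (rule bdd_above_mono) (use orb(2) in auto)
  qed
  \<comment> \<open>Beyond \<open>T1\<close> less than \<open>e\<close> is left to gain. The bound
    \<open>T1 + 1\<close> below leaves room for one unit step back towards the present.\<close>
  obtain T1 where T1: "T1 \<ge> 0" "(SUP t\<in>{0..}. V (\<gamma> t)) - e < V (\<gamma> T1)"
    using less_cSUP_iff[OF _ bdd, of "(SUP t\<in>{0..}. V (\<gamma> t)) - e"] e(1) by auto
  have near: "\<gamma> t \<in> (\<Union>c\<in>C. ball c (\<rho> c))" if "t \<ge> T1 + 1" for t
  proof (rule ccontr)
    assume "\<not> ?thesis"
    then have "\<gamma> t \<in> N'" using orb(2)[of t] that T1 by (auto simp: N'_def)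
    from e(2)[OF this] have "e \<le> V (\<gamma> t) - V (\<gamma> (t - 1))"
      using backward_orbitD[OF orb(1), of 1 t] that T1 by simp
    moreover have "V (\<gamma> t) \<le> (SUP t\<in>{0..}. V (\<gamma> t))"
      using that T1 by (intro cSUP_upper bdd) auto
    moreover have "V (\<gamma> T1) \<le> V (\<gamma> (t - 1))" using that T1 by (intro mono) auto
    ultimately show False using T1(2) by simp
  qed
  then obtain c where c: "c \<in> C" "\<gamma> (T1 + 1) \<in> ball c (\<rho> c)" by blast
  have "\<gamma> t \<in> ball c (\<rho> c)" if t: "t \<ge> T1 + 1" for t
  proof (rule ccontr)
    assume *: "\<gamma> t \<notin> ball c (\<rho> c)"
    let ?U = "\<Union>c'\<in>C - {c}. ball c' (\<rho> c')"
    have con: "connected (\<gamma> ` {T1 + 1..t})"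
      by (intro connected_continuous_image continuous_on_subset[OF continuous_on_backward_orbit[OF orb(1), of t]])
        (use T1 in auto)
    have "ball c (\<rho> c) \<inter> ?U = {}" using disj c(1) by blast
    moreover have "\<gamma> ` {T1 + 1..t} \<subseteq> ball c (\<rho> c) \<union> ?U" using near by force
    moreover have "\<gamma> (T1 + 1) \<in> ball c (\<rho> c) \<inter> \<gamma> ` {T1 + 1..t}" using c t by auto
    moreover have "\<gamma> t \<in> ?U \<inter> \<gamma> ` {T1 + 1..t}" using near[OF t] * t by auto
    ultimately show False
      using connectedD[OF con, of "ball c (\<rho> c)" ?U] by blast
  qed
  then have "\<gamma> t \<in> cball c (r c)" if "t \<ge> T1 + 1" for t
    using that by (force simp: \<rho>_def)
  with c(1) T1(1) show thesis by (intro that[of c "T1 + 1"]) auto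
qed

text \<open>A backward orbit is recovered from arbitrarily long finite histories because the time maps
  are injective.\<close>

lemma backward_orbit_from_histories:
  assumes "\<And>T. T \<ge> 0 \<Longrightarrow> \<exists>x. S T x = y \<and> (\<forall>s\<in>{0..T}. S s x \<in> N)"
  obtains \<gamma> where "backward_orbit \<gamma>" "\<gamma> 0 = y" "\<And>T. T \<ge> 0 \<Longrightarrow> \<gamma> T \<in> N"
proof -
  obtain \<gamma> where \<gamma>: "\<And>T. T \<ge> 0 \<Longrightarrow> S T (\<gamma> T) = y" "\<And>T s. 0 \<le> s \<Longrightarrow> s \<le> T \<Longrightarrow> S s (\<gamma> T) \<in> N"
    using assms by (metis (no_types, lifting) atLeastAtMost_iff order_trans)
  have "S h (\<gamma> T) = \<gamma> (T - h)" if "0 \<le> h" "h \<le> T" for h T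
  proof (rule flow_inj)
    show "S (T - h) (S h (\<gamma> T)) = S (T - h) (\<gamma> (T - h))"
      using flow_add[of "T - h" h "\<gamma> T"] \<gamma>(1)[of T] \<gamma>(1)[of "T - h"] that by simp
  qed (use that in simp)
  then have "backward_orbit \<gamma>" by (auto simp: backward_orbit_def)
  with \<gamma>(1)[of 0] \<gamma>(2)[of 0] show thesis by (intro that[of \<gamma>]) auto
qed

text \<open>Otherwise the endpoints outside \<open>U\<close> of stays in \<open>N\<close> of length
  \<open>n\<close> form nonempty compact sets, decreasing in \<open>n\<close>. A common point has
  arbitrarily long histories in \<open>N\<close>, so it ends a backward orbit in \<open>N\<close>
  and lies in \<open>M\<close> by \<open>inv\<close>, against
  \<open>M \<subseteq> U\<close>.\<close>

lemma long_orbit_ends_near: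
  assumes N: "compact N" and inv: "\<And>\<gamma>. backward_orbit \<gamma> \<Longrightarrow> (\<And>T. T \<ge> 0 \<Longrightarrow> \<gamma> T \<in> N) \<Longrightarrow> \<gamma> 0 \<in> M"
    and U: "open U" "M \<subseteq> U"
  obtains T where "T \<ge> 0" "\<And>x. (\<And>s. 0 \<le> s \<Longrightarrow> s \<le> T \<Longrightarrow> S s x \<in> N) \<Longrightarrow> S T x \<in> U"
proof (rule ccontr)
  assume contra: "\<not> thesis"
  define H where "H n = {x. \<forall>s\<in>{0..real n}. S s x \<in> N}" for n
  define K where "K n = S (real n) ` H n - U" for n
  have "\<Inter> (range K) \<noteq> {}"
  proof (rule compact_nest)
    fix n
    have "H n = N \<inter> (\<Inter>s\<in>{0..real n}. S s -` N)"
      by (force simp: H_def)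
    moreover have "closed (S s -` N)" if "s \<ge> 0" for s
      using continuous_on_closed_vimage[of UNIV "S s"] continuous_on_flow[OF that, of UNIV] N
      by (auto intro: compact_imp_closed)
    ultimately have "compact (H n)" using N by (auto intro!: compact_Int_closed closed_INT)
    then show "compact (K n)" unfolding K_def
      by (intro compact_diff U compact_continuous_image continuous_on_flow) auto
    have "\<not> (\<forall>x. (\<forall>s. 0 \<le> s \<longrightarrow> s \<le> real n \<longrightarrow> S s x \<in> N) \<longrightarrow> S (real n) x \<in> U)"
      using contra that[of "real n"] by auto
    then obtain x where "\<And>s. 0 \<le> s \<Longrightarrow> s \<le> real n \<Longrightarrow> S s x \<in> N" "S (real n) x \<notin> U"
      by blast
    then have "S (real n) x \<in> K n" by (simp add: K_def H_def)
    then show "K n \<noteq> {}" by blast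
  next
    fix i n :: nat assume le: "i \<le> n"
    show "K n \<subseteq> K i"
    proof
      fix y assume "y \<in> K n"
      then obtain x where x: "x \<in> H n" "y = S (real n) x" "y \<notin> U" by (auto simp: K_def)
      \<comment> \<open>Cutting off the first \<open>n - i\<close> time units shortens the history
        but keeps its endpoint.\<close>
      have "S (real n - real i) x \<in> H i"
        using x(1) le flow_add[of _ "real n - real i" x, symmetric] by (auto simp: H_def)
      moreover have "y = S (real i) (S (real n - real i) x)"
        using x(2) le flow_add[of "real i" "real n - real i" x] by simp
      ultimately show "y \<in> K i" using x(3) by (auto simp: K_def)
    qed
  qed
  then obtain y where y: "\<And>n. y \<in> K n" by auto
  have "\<exists>x. S T x = y \<and> (\<forall>s\<in>{0..T}. S s x \<in> N)" if "T \<ge> 0" for T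
  proof -
    obtain n where n: "T \<le> real n" using real_arch_simple by blast
    from y[of n] obtain x where x: "x \<in> H n" "y = S (real n) x" by (auto simp: K_def)
    have "S T (S (real n - T) x) = y" using flow_add[of T "real n - T" x] x(2) n that by simp
    moreover have "\<forall>s\<in>{0..T}. S s (S (real n - T) x) \<in> N"
      using x(1) n flow_add[of _ "real n - T" x, symmetric] by (auto simp: H_def)
    ultimately show ?thesis by blast
  qed
  from backward_orbit_from_histories[OF this] inv have "y \<in> M" by metis
  with y[of 0] U show False by (auto simp: K_def)
qed

text \<open>For a suitable \<open>T\<close>, a stay of length \<open>T\<close> in \<open>N\<close>
  ends in the interior. An orbit starting close enough to \<open>M\<close> remains in the interior
  up to time \<open>T\<close>; were it to leave later, the \<open>T\<close> time units before the
  first exit would be such a stay, and the exit point would be interior.\<close>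

lemma trapped_near_invariant_set:
  assumes N: "compact N" and inv: "\<And>\<gamma>. backward_orbit \<gamma> \<Longrightarrow> (\<And>T. T \<ge> 0 \<Longrightarrow> \<gamma> T \<in> N) \<Longrightarrow> \<gamma> 0 \<in> M"
    and M: "compact M" "M \<noteq> {}" "M \<subseteq> interior N" "\<And>x t. x \<in> M \<Longrightarrow> t \<ge> 0 \<Longrightarrow> S t x \<in> M"
  obtains \<delta> where "\<delta> > 0" "\<And>x t. infdist x M \<le> \<delta> \<Longrightarrow> t \<ge> 0 \<Longrightarrow> S t x \<in> N"
proof -
  obtain T where T: "T \<ge> 0"
    "\<And>x. (\<And>s. 0 \<le> s \<Longrightarrow> s \<le> T \<Longrightarrow> S s x \<in> N) \<Longrightarrow> S T x \<in> interior N"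
    by (rule long_orbit_ends_near[of N M "interior N"]) (use N inv M(3) in auto)
  obtain d where d: "d > 0" "\<And>x. infdist x M \<le> d \<Longrightarrow> x \<in> interior N"
    using compact_infdist_subset_open[OF M(1,2) open_interior M(3)] by metis
  \<comment> \<open>Dividing by \<open>exp (L * T)\<close> compensates the spreading of orbits up to
    time \<open>T\<close>.\<close>
  have "S t x \<in> N" if x: "infdist x M \<le> d / exp (L * T)" and t: "t \<ge> 0" for x t
  proof (rule ccontr)
    assume "S t x \<notin> N"
    then have notin: "S t x \<notin> interior N" using interior_subset by blast
    have start: "S s x \<in> interior N" if s: "0 \<le> s" "s \<le> T" for s
    proof (rule d(2))
      have "infdist (S s x) M \<le> exp (L * s) * infdist x M"
        using s M by (intro infdist_flow_le) auto
      also have "\<dots> \<le> exp (L * T) * (d / exp (L * T))"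
        using x s L_nonneg by (intro mult_mono) (auto intro: mult_left_mono infdist_nonneg)
      finally show "infdist (S s x) M \<le> d" by simp
    qed
    \<comment> \<open>Being outside the interior, rather than outside \<open>N\<close> itself, is a
      closed condition on time, so the first exit time is attained.\<close>
    define E where "E = {0..} \<inter> (\<lambda>s. S s x) -` (- interior N)"
    have "closed E" unfolding E_def
      by (intro continuous_closed_preimage continuous_on_flow_time) auto
    moreover have "t \<in> E" using t notin by (simp add: E_def)
    moreover have bdd: "bdd_below E" by (auto simp: E_def)
    ultimately have I: "Inf E \<in> E" by (intro closed_contains_Inf) auto
    define u where "u = Inf E"
    have before: "S s x \<in> N" if "0 \<le> s" "s < u" for s
    proof -
      have "s \<notin> E" using that cInf_lower[OF _ bdd, of s] by (auto simp: u_def)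
      with that show ?thesis using interior_subset by (auto simp: E_def)
    qed
    have u: "u > T" using I start[of u] by (fastforce simp: u_def E_def)
    \<comment> \<open>At the exit time itself membership in \<open>N\<close> is obtained as a limit
      from earlier times, \<open>N\<close> being closed.\<close>
    have "(\<lambda>s. S s x) ` closure {0..<u} \<subseteq> N"
      by (rule image_closure_subset) (use u T(1) N before in
        \<open>auto intro: continuous_on_subset[OF continuous_on_flow_time] compact_imp_closed\<close>)
    then have upto: "S s x \<in> N" if "0 \<le> s" "s \<le> u" for s using that u T(1) by auto
    have "S T (S (u - T) x) \<in> interior N"
    proof (rule T(2))
      fix s assume "0 \<le> s" "s \<le> T"
      then show "S s (S (u - T) x) \<in> N"
        using flow_add[of s "u - T" x] upto[of "s + (u - T)"] u by simp
    qed
    then have "S u x \<in> interior N" using flow_add[of T "u - T" x] T(1) u by simp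
    with I show False by (simp add: u_def E_def)
  qed
  with d(1) show thesis by (intro that[of "d / exp (L * T)"]) auto
qed

end

subsection \<open>Hessians\<close>

lemma grad_has_derivative:
  fixes f :: "real^'n \<Rightarrow> real"
  assumes "f differentiable (at x)"
  shows "(f has_derivative (\<lambda>h. grad f x \<bullet> h)) (at x)"
proof -
  let ?D = "frechet_derivative f (at x)"
  have D: "(f has_derivative ?D) (at x)" using assms by (simp add: frechet_derivative_works)
  have lin: "linear ?D" by (rule has_derivative_linear[OF D])
  have "?D h = grad f x \<bullet> h" for h
  proof -
    have "?D h = ?D (\<Sum>i\<in>UNIV. (h $ i) *\<^sub>R axis i 1)"
      using basis_expansion[of h] by (simp add: scalar_mult_eq_scaleR)
    also have "\<dots> = (\<Sum>i\<in>UNIV. (h $ i) * ?D (axis i 1))"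
      by (simp add: linear_sum[OF lin] linear_cmul[OF lin])
    also have "\<dots> = grad f x \<bullet> h"
      by (simp add: inner_vec_def grad_def partial_deriv_def mult.commute)
    finally show ?thesis .
  qed
  then have "?D = (\<lambda>h. grad f x \<bullet> h)" by auto
  with D show ?thesis by simp
qed

lemma partial_deriv_line:
  fixes f :: "real^'n \<Rightarrow> real"
  assumes "\<And>z. f differentiable (at z)"
  shows "((\<lambda>t. f (z + t *\<^sub>R axis i 1)) has_real_derivative partial_deriv i f (z + t *\<^sub>R axis i 1)) (at t)"
proof -
  have "((\<lambda>t. z + t *\<^sub>R axis i 1) has_derivative (\<lambda>h. h *\<^sub>R axis i 1)) (at t)"
    by (auto intro!: derivative_eq_intros)
  from diff_chain_at[OF this grad_has_derivative[OF assms]] show ?thesis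
    unfolding has_field_derivative_def o_def
    by (rule has_derivative_eq_rhs) (auto simp: fun_eq_iff inner_axis grad_def)
qed

text \<open>The mean value theorem is applied twice: in direction \<open>i\<close> to the difference
  of \<open>f\<close> along two parallel lines, then in direction \<open>j\<close> to
  \<open>partial_deriv i f\<close>.\<close>

lemma mixed_difference:
  fixes f :: "real^'n \<Rightarrow> real"
  assumes f: "\<And>z. f differentiable (at z)" "\<And>z. partial_deriv i f differentiable (at z)"
    and h: "h > 0"
  obtains \<xi> \<eta> where "\<xi> \<in> {0..h}" "\<eta> \<in> {0..h}"
    "f (x + h *\<^sub>R axis i 1 + h *\<^sub>R axis j 1) - f (x + h *\<^sub>R axis i 1) - f (x + h *\<^sub>R axis j 1) + f x
      = h\<^sup>2 * partial_deriv j (partial_deriv i f) (x + \<xi> *\<^sub>R axis i 1 + \<eta> *\<^sub>R axis j 1)"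
proof -
  let ?x' = "x + h *\<^sub>R axis j 1"
  let ?g = "\<lambda>t. f (?x' + t *\<^sub>R axis i 1) - f (x + t *\<^sub>R axis i 1)"
  have "\<exists>\<xi>>0. \<xi> < h \<and> ?g h - ?g 0 =
      (h - 0) * (partial_deriv i f (?x' + \<xi> *\<^sub>R axis i 1) - partial_deriv i f (x + \<xi> *\<^sub>R axis i 1))"
    by (intro MVT2 h DERIV_diff partial_deriv_line f)
  then obtain \<xi> where \<xi>: "0 < \<xi>" "\<xi> < h" "?g h - ?g 0 =
      h * (partial_deriv i f (?x' + \<xi> *\<^sub>R axis i 1) - partial_deriv i f (x + \<xi> *\<^sub>R axis i 1))" by auto
  let ?y = "x + \<xi> *\<^sub>R axis i 1"
  let ?p = "\<lambda>t. partial_deriv i f (?y + t *\<^sub>R axis j 1)"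
  have "\<exists>\<eta>>0. \<eta> < h \<and> ?p h - ?p 0 = (h - 0) * partial_deriv j (partial_deriv i f) (?y + \<eta> *\<^sub>R axis j 1)"
    by (intro MVT2 h partial_deriv_line f)
  then obtain \<eta> where \<eta>: "0 < \<eta>" "\<eta> < h"
    "?p h - ?p 0 = h * partial_deriv j (partial_deriv i f) (?y + \<eta> *\<^sub>R axis j 1)" by auto
  show thesis
  proof (rule that[of \<xi> \<eta>])
    have "?g h - ?g 0 = h * (?p h - ?p 0)" using \<xi>(3) by (simp add: add_ac)
    then show "f (x + h *\<^sub>R axis i 1 + h *\<^sub>R axis j 1) - f (x + h *\<^sub>R axis i 1) - f (x + h *\<^sub>R axis j 1) + f x
      = h\<^sup>2 * partial_deriv j (partial_deriv i f) (x + \<xi> *\<^sub>R axis i 1 + \<eta> *\<^sub>R axis j 1)"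
      using \<eta>(3) by (simp add: power2_eq_square add_ac)
  qed (use \<xi> \<eta> in auto)
qed

text \<open>The second difference of \<open>f\<close> is symmetric in \<open>i\<close> and
  \<open>j\<close>, and it equals \<open>h^2\<close> times either mixed derivative at some point
  near \<open>x\<close>. Continuity transfers the equality to \<open>x\<close>.\<close>

lemma partial_deriv_commute:
  fixes f :: "real^'n \<Rightarrow> real"
  assumes f: "\<And>z. f differentiable (at z)" "\<And>i z. partial_deriv i f differentiable (at z)"
    and cont: "\<And>i j. continuous_on UNIV (partial_deriv i (partial_deriv j f))"
  shows "partial_deriv j (partial_deriv i f) x = partial_deriv i (partial_deriv j f) x"
proof -
  let ?p = "partial_deriv j (partial_deriv i f)" and ?q = "partial_deriv i (partial_deriv j f)"
  have "\<bar>?p x - ?q x\<bar> \<le> e" if e: "e > 0" for e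
  proof -
    obtain d1 where d1: "d1 > 0" "\<And>y. dist y x < d1 \<Longrightarrow> dist (?p y) (?p x) < e / 2"
      using cont e unfolding continuous_on_iff by (metis UNIV_I half_gt_zero)
    obtain d2 where d2: "d2 > 0" "\<And>y. dist y x < d2 \<Longrightarrow> dist (?q y) (?q x) < e / 2"
      using cont e unfolding continuous_on_iff by (metis UNIV_I half_gt_zero)
    \<comment> \<open>Two steps of length at most \<open>h\<close> stay strictly within
      \<open>3 h\<close>, hence within both \<open>d1\<close> and \<open>d2\<close>.\<close>
    define h where "h = min d1 d2 / 3"
    have h: "h > 0" "3 * h \<le> d1" "3 * h \<le> d2" using d1 d2 by (auto simp: h_def)
    have near: "dist (x + s *\<^sub>R axis i' 1 + t *\<^sub>R axis j' 1) x < 3 * h"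
      if "s \<in> {0..h}" "t \<in> {0..h}" for s t and i' j' :: 'n
    proof -
      have "dist (x + s *\<^sub>R axis i' 1 + t *\<^sub>R axis j' 1) x = norm (s *\<^sub>R axis i' 1 + t *\<^sub>R axis j' (1::real))"
        by (simp add: dist_norm)
      also have "\<dots> \<le> \<bar>s\<bar> + \<bar>t\<bar>" by (rule norm_triangle_le) (simp add: norm_axis_1)
      finally show ?thesis using that h by simp
    qed
    obtain \<xi> \<eta> where 1: "\<xi> \<in> {0..h}" "\<eta> \<in> {0..h}"
      "f (x + h *\<^sub>R axis i 1 + h *\<^sub>R axis j 1) - f (x + h *\<^sub>R axis i 1) - f (x + h *\<^sub>R axis j 1) + f x
        = h\<^sup>2 * ?p (x + \<xi> *\<^sub>R axis i 1 + \<eta> *\<^sub>R axis j 1)"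
      using mixed_difference[OF f h(1), of x i j] by metis
    obtain \<xi>' \<eta>' where 2: "\<xi>' \<in> {0..h}" "\<eta>' \<in> {0..h}"
      "f (x + h *\<^sub>R axis j 1 + h *\<^sub>R axis i 1) - f (x + h *\<^sub>R axis j 1) - f (x + h *\<^sub>R axis i 1) + f x
        = h\<^sup>2 * ?q (x + \<xi>' *\<^sub>R axis j 1 + \<eta>' *\<^sub>R axis i 1)"
      using mixed_difference[OF f h(1), of x j i] by metis
    have "h\<^sup>2 * ?p (x + \<xi> *\<^sub>R axis i 1 + \<eta> *\<^sub>R axis j 1) = h\<^sup>2 * ?q (x + \<xi>' *\<^sub>R axis j 1 + \<eta>' *\<^sub>R axis i 1)"
      unfolding 1(3)[symmetric] 2(3)[symmetric] by (simp add: add_ac)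
    then have "?p (x + \<xi> *\<^sub>R axis i 1 + \<eta> *\<^sub>R axis j 1) = ?q (x + \<xi>' *\<^sub>R axis j 1 + \<eta>' *\<^sub>R axis i 1)"
      using h(1) by simp
    moreover have "dist (?p (x + \<xi> *\<^sub>R axis i 1 + \<eta> *\<^sub>R axis j 1)) (?p x) < e / 2"
      using near[OF 1(1,2), of i j] h by (intro d1) simp
    moreover have "dist (?q (x + \<xi>' *\<^sub>R axis j 1 + \<eta>' *\<^sub>R axis i 1)) (?q x) < e / 2"
      using near[OF 2(1,2), of j i] h by (intro d2) simp
    ultimately show ?thesis by (simp add: dist_real_def abs_if split: if_splits)
  qed
  then have "\<bar>?p x - ?q x\<bar> \<le> 0" by (rule field_le_epsilon[where y = 0, simplified])
  then show ?thesis by simp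
qed

lemma times_continuously_differentiable_imp:
  fixes V :: "real^'n \<Rightarrow> real"
  assumes "times_continuously_differentiable 3 V"
  shows "V differentiable (at x)" "partial_deriv i V differentiable (at x)"
    "continuous_on UNIV (partial_deriv i (partial_deriv j V))"
  using assms
  by (auto simp: numeral_3_eq_3 intro!: differentiable_imp_continuous_on
      simp: differentiable_on_def differentiable_at_withinI)

text \<open>In \<open>hessian\<close> the row index belongs to the outer derivative, whereas in the
  Jacobian of \<open>grad V\<close> the direction of differentiation is the column index; hence the
  transpose, which symmetry removes later.\<close>

lemma grad_has_derivative_hessian:
  fixes V :: "real^'n \<Rightarrow> real"
  assumes "\<And>i. partial_deriv i V differentiable (at x)"
  shows "(grad V has_derivative (*v) (transpose (hessian V x))) (at x)"
proof -
  have "((\<lambda>y. \<chi> j. partial_deriv j V y) has_derivative (\<lambda>h. \<chi> j. grad (partial_deriv j V) x \<bullet> h)) (at x)"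
    by (subst has_derivative_componentwise_within)
      (auto simp: Basis_vec_def inner_axis intro!: grad_has_derivative[OF assms])
  moreover have "(\<lambda>h. \<chi> j. grad (partial_deriv j V) x \<bullet> h) = (*v) (transpose (hessian V x))"
    by (auto simp: fun_eq_iff vec_eq_iff matrix_vector_mult_def transpose_def hessian_def grad_def
        inner_vec_def)
  moreover have "grad V = (\<lambda>y. \<chi> j. partial_deriv j V y)" by (auto simp: grad_def)
  ultimately show ?thesis by simp
qed

lemma transpose_hessian:
  fixes V :: "real^'n \<Rightarrow> real"
  assumes "times_continuously_differentiable 3 V"
  shows "transpose (hessian V x) = hessian V x"
  using partial_deriv_commute[OF times_continuously_differentiable_imp[OF assms]]
  by (simp add: transpose_def hessian_def vec_eq_iff)

text \<open>The mean value inequality for \<open>grad V\<close> minus its linearization, on a ball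
  where the second partial derivatives have barely changed. The estimate compares two arbitrary
  points of the ball, as is needed for the difference of two orbits.\<close>

lemma grad_linearization:
  fixes V :: "real^'n \<Rightarrow> real"
  assumes V: "times_continuously_differentiable 3 V" and e: "e > 0"
  obtains r where "r > 0" "\<And>x y. x \<in> cball c r \<Longrightarrow> y \<in> cball c r \<Longrightarrow>
    norm (grad V x - grad V y - hessian V c *v (x - y)) \<le> e * norm (x - y)"
proof -
  \<comment> \<open>The operator norm of a matrix is at most the number of its entries times a bound
    on them.\<close>
  define e' where "e' = e / (real CARD('n) * real CARD('n))"
  have e': "e' > 0" using e by (simp add: e'_def)
  have "\<forall>\<^sub>F x in nhds c. \<forall>i j. \<bar>(hessian V x - hessian V c) $ i $ j\<bar> \<le> e'"
  proof (intro eventually_all_finite)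
    fix i j
    have "isCont (partial_deriv i (partial_deriv j V)) c"
      using times_continuously_differentiable_imp(3)[OF V] by (simp add: continuous_on_eq_continuous_at)
    then have "\<forall>\<^sub>F x in nhds c. dist (partial_deriv i (partial_deriv j V) x) (partial_deriv i (partial_deriv j V) c) < e'"
      using e' unfolding isCont_def tendsto_at_iff_tendsto_nhds by (rule tendstoD)
    then show "\<forall>\<^sub>F x in nhds c. \<bar>(hessian V x - hessian V c) $ i $ j\<bar> \<le> e'"
      by eventually_elim (simp add: hessian_def dist_real_def)
  qed
  then obtain d where d: "d > 0" "\<And>x. dist x c < d \<Longrightarrow> \<forall>i j. \<bar>(hessian V x - hessian V c) $ i $ j\<bar> \<le> e'"
    unfolding eventually_nhds_metric by blast
  show thesis
  proof (rule that[of "d / 2"])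
    fix x y assume xy: "x \<in> cball c (d / 2)" "y \<in> cball c (d / 2)"
    let ?g = "\<lambda>z. grad V z - hessian V c *v z"
    have "norm (?g x - ?g y) \<le> e * norm (x - y)"
    proof (rule differentiable_bound[OF convex_cball _ _ xy])
      fix z assume z: "z \<in> cball c (d / 2)"
      have "(grad V has_derivative (*v) (hessian V z)) (at z)"
        using grad_has_derivative_hessian[OF times_continuously_differentiable_imp(2)[OF V], of z]
        by (simp add: transpose_hessian[OF V])
      then have "(?g has_derivative (\<lambda>h. hessian V z *v h - hessian V c *v h)) (at z)"
        by (rule has_derivative_diff[OF _ bounded_linear_imp_has_derivative[OF matrix_vector_mul_bounded_linear]])
      then show "(?g has_derivative (\<lambda>h. (hessian V z - hessian V c) *v h)) (at z within cball c (d / 2))"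
        unfolding matrix_vector_mult_diff_rdistrib by (rule has_derivative_at_withinI)
      have "onorm ((*v) (hessian V z - hessian V c)) \<le> real CARD('n) * real CARD('n) * e'"
        using d(2)[of z] d(1) z by (intro onorm_le_matrix_component) (auto simp: dist_commute)
      then show "onorm ((*v) (hessian V z - hessian V c)) \<le> e" by (simp add: e'_def)
    qed
    then show "norm (grad V x - grad V y - hessian V c *v (x - y)) \<le> e * norm (x - y)"
      by (simp add: matrix_vector_mult_diff_distrib algebra_simps)
  qed (use d in simp)
qed

lemma symmetric_matrix_inner:
  fixes A :: "real^'n^'n"
  assumes "transpose A = A"
  shows "(A *v x) \<bullet> y = x \<bullet> (A *v y)"
  by (metis assms dot_lmul_matrix inner_commute transpose_matrix_vector)

lemma matrix_bounded_below:
  fixes A :: "real^'n^'n"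
  assumes "\<And>v. A *v v = 0 \<Longrightarrow> v = 0"
  obtains k where "k > 0" "\<And>v. k * norm v \<le> norm (A *v v)"
proof -
  have "linear ((*v) A)" "inj ((*v) A)"
    using assms by (auto simp: linear_injective_0)
  then show thesis using linear_inj_bounded_below_pos that by metis
qed

lemma nonneg_quadratic_no_linear_term:
  fixes p q :: real
  assumes "\<And>t. 0 \<le> 2 * t * p + t\<^sup>2 * q"
  shows "p = 0"
proof (rule ccontr)
  assume p: "p \<noteq> 0"
  \<comment> \<open>At \<open>t = - p / u\<close> the expression equals
    \<open>p^2 * (q - 2 * u) / u^2\<close>, which is negative because
    \<open>u > |q|\<close>.\<close>
  define u where "u = \<bar>q\<bar> + 1"
  have u: "u > 0" by (simp add: u_def)
  have "0 \<le> (2 * (- p / u) * p + (- p / u)\<^sup>2 * q) * u\<^sup>2"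
    by (rule mult_nonneg_nonneg[OF assms]) simp
  also have "\<dots> = p\<^sup>2 * (q - 2 * u)" using u by (simp add: field_simps power2_eq_square)
  finally have "q - 2 * u \<ge> 0" using p by (simp add: zero_le_mult_iff)
  then show False by (simp add: u_def abs_if split: if_splits)
qed

text \<open>A minimizer of the quadratic form on the unit sphere of \<open>e\<^sup>\<bottom>\<close> is an eigenvector; were its
  eigenvalue negative, the negative eigenvalue would not be simple.\<close>

lemma one_negative_nonneg_on_complement:
  fixes A :: "real^'n^'n"
  assumes sym: "transpose A = A" and A: "one_negative_others_positive A"
  obtains e where "\<And>w. e \<bullet> w = 0 \<Longrightarrow> w \<bullet> (A *v w) \<ge> 0"
proof -
  obtain l where l: "l < 0" "eigenvalue A l" "dim (eigenspace A l) = 1"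
      "\<And>\<mu>. eigenvalue A \<mu> \<Longrightarrow> \<mu> \<noteq> l \<Longrightarrow> \<mu> > 0"
    using A by (auto simp: one_negative_others_positive_def)
  obtain e where e: "e \<noteq> 0" "A *v e = l *\<^sub>R e"
    using l(2) by (auto simp: eigenvalue_def eigenspace_def)
  have "w \<bullet> (A *v w) \<ge> 0" if w: "e \<bullet> w = 0" for w
  proof (rule ccontr)
    assume neg: "\<not> w \<bullet> (A *v w) \<ge> 0"
    then have w0: "w \<noteq> 0" by auto
    define K where "K = sphere 0 1 \<inter> {w. e \<bullet> w = 0}"
    have K: "compact K" unfolding K_def
      by (intro compact_Int_closed) (auto simp: closed_hyperplane)
    have normalize: "x /\<^sub>R norm x \<in> K" if "e \<bullet> x = 0" "x \<noteq> 0" for x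
      using that by (simp add: K_def)
    have "continuous_on K (\<lambda>x. x \<bullet> (A *v x))"
      by (intro continuous_intros linear_continuous_on_compose[OF continuous_on_id]) simp
    then obtain v where v: "v \<in> K" "\<And>x. x \<in> K \<Longrightarrow> v \<bullet> (A *v v) \<le> x \<bullet> (A *v x)"
      using continuous_attains_inf[OF K] normalize[OF w w0] by blast
    define \<mu> where "\<mu> = v \<bullet> (A *v v)"
    have v1: "norm v = 1" "e \<bullet> v = 0" using v(1) by (auto simp: K_def)
    have scaled: "(x /\<^sub>R norm x) \<bullet> (A *v (x /\<^sub>R norm x)) = x \<bullet> (A *v x) / (norm x)\<^sup>2" for x
      by (simp add: matrix_vector_mult_scaleR power2_eq_square divide_inverse)
    have min: "\<mu> * (norm x)\<^sup>2 \<le> x \<bullet> (A *v x)" if x: "e \<bullet> x = 0" for x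
    proof (cases "x = 0")
      case False
      then show ?thesis
        using v(2)[OF normalize[OF x False]] unfolding scaled by (simp add: \<mu>_def field_simps)
    qed simp
    have "\<mu> \<le> w \<bullet> (A *v w) / (norm w)\<^sup>2"
      using v(2)[OF normalize[OF w w0]] unfolding scaled by (simp add: \<mu>_def)
    also have "\<dots> < 0" using neg w0 by (auto simp: divide_less_0_iff)
    finally have \<mu>: "\<mu> < 0" .
    \<comment> \<open>\<open>z\<close> is the part of \<open>A *v v\<close> orthogonal to the unit
      vector \<open>v\<close>. It also lies in the hyperplane orthogonal to \<open>e\<close>, so
      \<open>v + t z\<close> is an admissible competitor and minimality forces the term linear in
      \<open>t\<close>, namely \<open>2 t |z|^2\<close>, to vanish.\<close>
    define z where "z = A *v v - \<mu> *\<^sub>R v"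
    have "e \<bullet> (A *v v) = 0"
      using symmetric_matrix_inner[OF sym, of e v] e(2) v1 by simp
    then have z: "e \<bullet> z = 0" using v1 by (simp add: z_def inner_diff_right)
    have "z \<bullet> z = 0"
    proof (rule nonneg_quadratic_no_linear_term)
      fix t
      have Av: "A *v v = z + \<mu> *\<^sub>R v" by (simp add: z_def)
      have vz: "v \<bullet> (A *v z) = z \<bullet> z + \<mu> * (z \<bullet> v)"
        using symmetric_matrix_inner[OF sym, of v z] by (simp add: Av inner_add_left inner_commute[of v z])
      have vAv: "v \<bullet> z = 0"
        using v1 by (simp add: z_def inner_diff_right \<mu>_def power2_norm_eq_inner[symmetric])
      have vv: "v \<bullet> v = 1" using v1 by (simp add: power2_norm_eq_inner[symmetric])
      have "e \<bullet> (v + t *\<^sub>R z) = 0" using v1 z by (simp add: inner_add_right)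
      from min[OF this]
      have "\<mu> * ((v + t *\<^sub>R z) \<bullet> (v + t *\<^sub>R z)) \<le> (v + t *\<^sub>R z) \<bullet> (A *v (v + t *\<^sub>R z))"
        by (simp only: power2_norm_eq_inner)
      then show "0 \<le> 2 * t * (z \<bullet> z) + t\<^sup>2 * (z \<bullet> (A *v z) - \<mu> * (z \<bullet> z))"
        by (simp add: matrix_vector_right_distrib matrix_vector_mult_scaleR inner_add_left
            inner_add_right Av vz vAv vv inner_commute[of z v] power2_eq_square algebra_simps)
    qed
    then have "A *v v = \<mu> *\<^sub>R v" by (simp add: z_def)
    then have v_eig: "v \<in> eigenspace A \<mu>" by (simp add: eigenspace_def)
    moreover have "v \<noteq> 0" using v1 by auto
    ultimately have "eigenvalue A \<mu>" by (auto simp: eigenvalue_def)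
    with l(4)[of \<mu>] \<mu> have "\<mu> = l" by fastforce
    have "independent {e, v}"
      using e(1) \<open>v \<noteq> 0\<close> v1
      by (intro pairwise_orthogonal_independent) (auto simp: pairwise_def orthogonal_def inner_commute)
    moreover have "{e, v} \<subseteq> eigenspace A l" using e(2) v_eig \<open>\<mu> = l\<close> by (auto simp: eigenspace_def)
    ultimately have "card {e, v} \<le> 1" using independent_card_le_dim l(3) by metis
    moreover have "e \<noteq> v" using v1 e(1) by auto
    ultimately show False by simp
  qed
  then show thesis by (rule that)
qed

lemma one_negative_nondegenerate:
  fixes A :: "real^'n^'n"
  assumes "one_negative_others_positive A" "A *v v = 0"
  shows "v = 0"
proof (rule ccontr)
  assume "v \<noteq> 0"
  with assms(2) have "eigenvalue A 0" by (auto simp: eigenvalue_def eigenspace_def)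
  with assms(1) show False by (force simp: one_negative_others_positive_def)
qed

subsection \<open>Sets connecting the ends of an arc\<close>

text \<open>By injectivity, removing a ball around \<open>p\<close> leaves two compact pieces of the
  arc at positive distance. A set in a thin neighbourhood of the arc that avoids the ball is covered
  by disjoint closed neighbourhoods of these pieces and meets both of them at the ends, so it is
  disconnected.\<close>

lemma arc_point_near_connecting_set:
  fixes \<phi> :: "real \<Rightarrow> 'a::heine_borel"
  assumes cont: "continuous_on {a..b} \<phi>" and inj: "inj_on \<phi> {a..b}"
    and p: "p \<in> \<phi> ` {a..b}" and e: "e > 0"
  obtains d where "d > 0" "\<And>\<Gamma>. connected \<Gamma> \<Longrightarrow> \<phi> a \<in> \<Gamma> \<Longrightarrow> \<phi> b \<in> \<Gamma> \<Longrightarrow>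
    (\<And>x. x \<in> \<Gamma> \<Longrightarrow> infdist x (\<phi> ` {a..b}) \<le> d) \<Longrightarrow> \<Gamma> \<inter> ball p e \<noteq> {}"
proof -
  obtain \<alpha> where \<alpha>: "\<alpha> \<in> {a..b}" "p = \<phi> \<alpha>" using p by blast
  define A1 where "A1 = \<phi> ` {a..\<alpha>} - ball p (e / 2)"
  define A2 where "A2 = \<phi> ` {\<alpha>..b} - ball p (e / 2)"
  have comp: "compact A1" "compact A2" unfolding A1_def A2_def
    by (intro compact_diff open_ball compact_continuous_image continuous_on_subset[OF cont] compact_Icc;
        use \<alpha> in auto)+
  have "A1 \<inter> A2 = {}"
  proof -
    have "\<phi> ` {a..\<alpha>} \<inter> \<phi> ` {\<alpha>..b} = \<phi> ` ({a..\<alpha>} \<inter> {\<alpha>..b})"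
      by (rule inj_on_image_Int[OF inj, symmetric]) (use \<alpha> in auto)
    also have "\<dots> = {p}" using \<alpha> by (auto simp: Int_atLeastAtMost)
    finally have "\<phi> ` {a..\<alpha>} \<inter> \<phi> ` {\<alpha>..b} = {p}" .
    moreover have "p \<in> ball p (e / 2)" using e by simp
    moreover have "A1 \<inter> A2 = \<phi> ` {a..\<alpha>} \<inter> \<phi> ` {\<alpha>..b} - ball p (e / 2)"
      unfolding A1_def A2_def by blast
    ultimately show ?thesis using e by simp
  qed
  from separate_compact_closed[OF comp(1) compact_imp_closed[OF comp(2)] this]
  obtain h where h: "h > 0" "\<And>x y. x \<in> A1 \<Longrightarrow> y \<in> A2 \<Longrightarrow> h \<le> dist x y" by metis
  \<comment> \<open>\<open>h / 3\<close> keeps the \<open>d\<close>-neighbourhoods of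
    \<open>A1\<close> and \<open>A2\<close> disjoint; \<open>e / 2\<close> ensures that an arc point
    within \<open>d\<close> of a point outside \<open>ball p e\<close> lies outside the removed
    \<open>ball p (e / 2)\<close>.\<close>
  define d where "d = min (h / 3) (e / 2)"
  have d: "d > 0" "3 * d \<le> h" "2 * d \<le> e" using h(1) e by (auto simp: d_def)
  show thesis
  proof (rule that[OF d(1)])
    fix \<Gamma> assume \<Gamma>: "connected \<Gamma>" "\<phi> a \<in> \<Gamma>" "\<phi> b \<in> \<Gamma>"
      "\<And>x. x \<in> \<Gamma> \<Longrightarrow> infdist x (\<phi> ` {a..b}) \<le> d"
    show "\<Gamma> \<inter> ball p e \<noteq> {}"
    proof
      assume avoid: "\<Gamma> \<inter> ball p e = {}"
      define U where "U A = (\<Union>z\<in>A. cball z d)" for A :: "'a set"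
      have closed: "closed (U A)" if "compact A" for A
        using compact_minkowski_sum_cball[OF that, of d] by (simp add: U_def compact_imp_closed)
      have "\<Gamma> \<subseteq> U A1 \<union> U A2"
      proof
        fix x assume x: "x \<in> \<Gamma>"
        have "compact (\<phi> ` {a..b})" "\<phi> ` {a..b} \<noteq> {}"
          using compact_continuous_image[OF cont] p by auto
        then obtain z where z: "z \<in> \<phi> ` {a..b}" "dist x z \<le> d"
          using infdist_attains_inf[of "\<phi> ` {a..b}" x] \<Gamma>(4)[OF x] by (metis compact_imp_closed)
        have "dist p x \<ge> e" using avoid x by auto
        then have "z \<notin> ball p (e / 2)"
          using dist_triangle[of p x z] z(2) d(3) by (simp add: dist_commute)
        moreover have "\<phi> ` {a..b} = \<phi> ` {a..\<alpha>} \<union> \<phi> ` {\<alpha>..b}"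
          using \<alpha>(1) by (auto simp: image_Un[symmetric] ivl_disj_un_two_touch)
        ultimately have "z \<in> A1 \<union> A2" using z(1) by (auto simp: A1_def A2_def)
        with z(2) show "x \<in> U A1 \<union> U A2" by (auto simp: U_def dist_commute)
      qed
      moreover have "U A1 \<inter> U A2 = {}"
      proof safe
        fix x assume "x \<in> U A1" "x \<in> U A2"
        then obtain y z where "y \<in> A1" "z \<in> A2" "dist y x \<le> d" "dist z x \<le> d" by (auto simp: U_def)
        with h(2)[of y z] dist_triangle[of y z x] d show "x \<in> {}" by (simp add: dist_commute)
      qed
      moreover have "A \<subseteq> U A" for A using d(1) by (force simp: U_def)
      moreover have "\<Gamma> \<inter> ball p (e / 2) = {}" using avoid e by (auto simp: disjoint_iff)
      then have "\<phi> a \<in> A1" "\<phi> b \<in> A2" using \<Gamma>(2,3) \<alpha>(1) by (auto simp: A1_def A2_def)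
      ultimately show False
        using connected_closedD[OF \<Gamma>(1), of "U A1" "U A2"] \<Gamma>(2,3) closed comp by blast
    qed
  qed
qed

text \<open>Finitely many balls of radius \<open>e / 2\<close> cover the arc, which makes the
  \<open>d\<close> of the pointwise version uniform in \<open>p\<close>.\<close>

lemma arc_near_connecting_set:
  fixes \<phi> :: "real \<Rightarrow> 'a::heine_borel"
  assumes cont: "continuous_on {a..b} \<phi>" and inj: "inj_on \<phi> {a..b}" and e: "e > 0"
  obtains d where "d > 0" "\<And>\<Gamma> p. connected \<Gamma> \<Longrightarrow> \<phi> a \<in> \<Gamma> \<Longrightarrow> \<phi> b \<in> \<Gamma> \<Longrightarrow>
    (\<And>x. x \<in> \<Gamma> \<Longrightarrow> infdist x (\<phi> ` {a..b}) \<le> d) \<Longrightarrow> p \<in> \<phi> ` {a..b} \<Longrightarrow> infdist p \<Gamma> \<le> e"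
proof -
  let ?M = "\<phi> ` {a..b}"
  define good where "good p d \<longleftrightarrow> d > 0 \<and> (\<forall>\<Gamma>. connected \<Gamma> \<longrightarrow> \<phi> a \<in> \<Gamma> \<longrightarrow> \<phi> b \<in> \<Gamma> \<longrightarrow>
      (\<forall>x\<in>\<Gamma>. infdist x ?M \<le> d) \<longrightarrow> \<Gamma> \<inter> ball p (e / 2) \<noteq> {})" for p d
  have "\<exists>d. good p d" if pM: "p \<in> ?M" for p
  proof -
    obtain d where "d > 0" "\<And>\<Gamma>. connected \<Gamma> \<Longrightarrow> \<phi> a \<in> \<Gamma> \<Longrightarrow> \<phi> b \<in> \<Gamma> \<Longrightarrow>
        (\<And>x. x \<in> \<Gamma> \<Longrightarrow> infdist x ?M \<le> d) \<Longrightarrow> \<Gamma> \<inter> ball p (e / 2) \<noteq> {}"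
      by (rule arc_point_near_connecting_set[OF cont inj pM, of "e / 2"]) (use e in auto)
    then have "good p d" unfolding good_def by blast
    then show ?thesis by blast
  qed
  then obtain d where d: "\<And>p. p \<in> ?M \<Longrightarrow> good p (d p)" by metis
  have "compact ?M" by (rule compact_continuous_image[OF cont compact_Icc])
  moreover have "?M \<subseteq> (\<Union>p\<in>?M. ball p (e / 2))" using e by force
  ultimately obtain D where D: "D \<subseteq> ?M" "finite D" "?M \<subseteq> (\<Union>p\<in>D. ball p (e / 2))"
    using compactE_image[of ?M ?M "\<lambda>p. ball p (e / 2)"] by blast
  \<comment> \<open>The 1 keeps the minimum meaningful when the arc, and with it \<open>D\<close>,
    is empty.\<close>
  define d0 where "d0 = Min (insert 1 (d ` D))"
  have d0: "d0 > 0" "\<And>p. p \<in> D \<Longrightarrow> d0 \<le> d p"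
    using D(1,2) d by (auto simp: d0_def good_def)
  show thesis
  proof (rule that[OF d0(1)])
    fix \<Gamma> p assume \<Gamma>: "connected \<Gamma>" "\<phi> a \<in> \<Gamma>" "\<phi> b \<in> \<Gamma>" "\<And>x. x \<in> \<Gamma> \<Longrightarrow> infdist x ?M \<le> d0"
      and p: "p \<in> ?M"
    obtain q where q: "q \<in> D" "p \<in> ball q (e / 2)" using p D(3) by blast
    have "\<Gamma> \<inter> ball q (e / 2) \<noteq> {}"
      using d[of q] \<Gamma> q(1) D(1) d0(2)[OF q(1)] unfolding good_def by (meson order_trans subsetD)
    then obtain y where "y \<in> \<Gamma>" "dist q y < e / 2" by auto
    then show "infdist p \<Gamma> \<le> e"
      using infdist_le[of y \<Gamma> p] q(2) dist_triangle[of p y q] by (simp add: dist_commute)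
  qed
qed

section \<open>One-sided distances in terms of \<open>infdist\<close>\<close>

lemma one_sided_dist_eq: "Y \<noteq> {} \<Longrightarrow> one_sided_dist X Y = (SUP x\<in>X. infdist x Y)"
  by (simp add: one_sided_dist_def infdist_notempty dist_norm)

lemma one_sided_dist_le:
  assumes "X \<noteq> {}" "Y \<noteq> {}" "\<And>x. x \<in> X \<Longrightarrow> infdist x Y \<le> e"
  shows "one_sided_dist X Y \<le> e"
  using assms by (simp add: one_sided_dist_eq cSUP_least)

text \<open>Compactness bounds the distances from above, so that the real supremum is a genuine
  upper bound.\<close>

lemma infdist_le_one_sided_dist:
  assumes "compact X" "Y \<noteq> {}" "x \<in> X"
  shows "infdist x Y \<le> one_sided_dist X Y"
proof -
  have "compact ((\<lambda>x. infdist x Y) ` X)"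
    by (intro compact_continuous_image continuous_intros assms)
  then have "bdd_above ((\<lambda>x. infdist x Y) ` X)"
    by (intro bounded_imp_bdd_above compact_imp_bounded)
  then show ?thesis unfolding one_sided_dist_eq[OF assms(2)] by (rule cSUP_upper[OF assms(3)])
qed

section \<open>Backward orbits near nondegenerate critical points\<close>

context lipschitz_gradient_flow
begin

text \<open>The coordinate \<open>e \<bullet> (x - c)\<close> separates the points of local backward orbits.  The two given
  trajectories sweep out both signs of it, so no room is left for other backward orbits.\<close>

lemma backward_orbit_in_two_trajectories:
  assumes eq: "\<And>\<gamma> \<delta>. backward_orbit \<gamma> \<Longrightarrow> backward_orbit \<delta> \<Longrightarrow>
      (\<And>T. T \<ge> 0 \<Longrightarrow> \<gamma> T \<in> cball c r) \<Longrightarrow> (\<And>T. T \<ge> 0 \<Longrightarrow> \<delta> T \<in> cball c r) \<Longrightarrow>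
      e \<bullet> (\<gamma> 0 - \<delta> 0) = 0 \<Longrightarrow> \<gamma> 0 = \<delta> 0"
    and r: "r > 0" and c: "G c = 0"
    and g: "\<And>t. (g1 has_vector_derivative - G (g1 t)) (at t)"
      "\<And>t. (g2 has_vector_derivative - G (g2 t)) (at t)"
    and lim: "(g1 \<longlongrightarrow> c) at_bot" "(g2 \<longlongrightarrow> c) at_bot"
    and disj: "c \<notin> range g1" "c \<notin> range g2" "range g1 \<inter> range g2 = {}"
  obtains r' where "r' > 0" "\<And>\<gamma>. backward_orbit \<gamma> \<Longrightarrow> (\<And>T. T \<ge> 0 \<Longrightarrow> \<gamma> T \<in> cball c r') \<Longrightarrow>
    \<gamma> 0 \<in> insert c (range g1 \<union> range g2)"
proof -
  define u where "u x = e \<bullet> (x - c)" for x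
  have u_eq: "\<gamma> 0 = \<delta> 0" if "backward_orbit \<gamma>" "backward_orbit \<delta>"
    "\<And>T. T \<ge> 0 \<Longrightarrow> \<gamma> T \<in> cball c r" "\<And>T. T \<ge> 0 \<Longrightarrow> \<delta> T \<in> cball c r" "u (\<gamma> 0) = u (\<delta> 0)" for \<gamma> \<delta>
    using eq[of \<gamma> \<delta>] that by (simp add: u_def inner_diff_right)
  have "\<forall>\<^sub>F t in at_bot. g1 t \<in> cball c r \<and> g2 t \<in> cball c r"
    using tendstoD[OF lim(1) r] tendstoD[OF lim(2) r]
    by eventually_elim (auto simp: dist_commute)
  then obtain t0 where t0: "\<And>t. t \<le> t0 \<Longrightarrow> g1 t \<in> cball c r" "\<And>t. t \<le> t0 \<Longrightarrow> g2 t \<in> cball c r"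
    unfolding eventually_at_bot_linorder by blast
  \<comment> \<open>By \<open>u_eq\<close> a zero of the coordinate would put \<open>c\<close> on
    the trajectory. The term \<open>t - 0\<close> is the value at 0 of the backward orbit
    \<open>\<lambda>T. g (t - T)\<close>.\<close>
  have nz: "u (g t) \<noteq> 0"
    if "\<And>t. (g has_vector_derivative - G (g t)) (at t)" "c \<notin> range g"
      "\<And>t. t \<le> t0 \<Longrightarrow> g t \<in> cball c r" "t \<le> t0" for g t
  proof
    assume "u (g t) = 0"
    then have "g (t - 0) = c"
      using that(3,4) r
      by (intro u_eq[OF backward_orbit_entire_solution[OF that(1)] backward_orbit_critical[OF c]])
        (auto simp: u_def)
    with that(2) show False by (metis rangeI)
  qed
  \<comment> \<open>Dividing by \<open>u (g t0)\<close> treats both signs together: the quotient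
    tends to 0 in the infinite past and is 1 at \<open>t0\<close>, so the intermediate value theorem
    applies.\<close>
  have sweep: "\<exists>t\<le>t0. u (g t) = v"
    if g: "\<And>t. (g has_vector_derivative - G (g t)) (at t)" and "(g \<longlongrightarrow> c) at_bot"
      and v: "0 < v / u (g t0)" "v / u (g t0) \<le> 1" for g v
  proof -
    let ?f = "\<lambda>t. u (g t) / u (g t0)"
    have w: "u (g t0) \<noteq> 0" using v(1) by auto
    have "(?f \<longlongrightarrow> u c / u (g t0)) at_bot"
      unfolding u_def by (intro tendsto_intros that w[unfolded u_def])
    then have "\<forall>\<^sub>F t in at_bot. ?f t < v / u (g t0)"
      by (rule order_tendstoD) (use v in \<open>simp add: u_def\<close>)
    then obtain t1 where "\<And>t. t \<le> t1 \<Longrightarrow> ?f t < v / u (g t0)"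
      unfolding eventually_at_bot_linorder by blast
    then have t1: "?f (min t0 t1) < v / u (g t0)" by simp
    have "continuous_on {min t0 t1..t0} g"
      using g by (intro continuous_at_imp_continuous_on) (auto intro: has_vector_derivative_continuous)
    then have "continuous_on {min t0 t1..t0} ?f"
      unfolding u_def using w by (intro continuous_intros) (auto simp: u_def)
    with t1 v w obtain t where "t \<le> t0" "?f t = v / u (g t0)"
      using IVT'[of ?f "min t0 t1" "v / u (g t0)" t0] by (auto simp: less_imp_le)
    with w show ?thesis by auto
  qed
  note nz1 = nz[OF g(1) disj(1) t0(1)] and nz2 = nz[OF g(2) disj(2) t0(2)]
  define w1 where "w1 = u (g1 t0)"
  define w2 where "w2 = u (g2 t0)"
  have w: "w1 \<noteq> 0" "w2 \<noteq> 0" using nz1 nz2 by (simp_all add: w1_def w2_def)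
  \<comment> \<open>With equal signs both trajectories would attain whichever of \<open>w1\<close>
    and \<open>w2\<close> is smaller in absolute value, and points with the same coordinate
    coincide, against disjointness.\<close>
  have opp: "w1 * w2 < 0"
  proof (rule ccontr)
    assume "\<not> w1 * w2 < 0"
    with w have same: "w1 * w2 > 0" by (metis linorder_neqE_linordered_idom mult_eq_0_iff)
    define v where "v = (if \<bar>w1\<bar> \<le> \<bar>w2\<bar> then w1 else w2)"
    have v: "0 < v / w1" "v / w1 \<le> 1" "0 < v / w2" "v / w2 \<le> 1"
      using same w by (auto simp: v_def zero_less_mult_iff zero_less_divide_iff divide_le_eq)
    obtain t1 where t1: "t1 \<le> t0" "u (g1 t1) = v" using sweep[OF g(1) lim(1)] v by (auto simp: w1_def)
    obtain t2 where t2: "t2 \<le> t0" "u (g2 t2) = v" using sweep[OF g(2) lim(2)] v by (auto simp: w2_def)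
    have "g1 (t1 - 0) = g2 (t2 - 0)"
      using t1 t2 t0 by (intro u_eq backward_orbit_entire_solution g) auto
    with disj(3) show False by auto
  qed
  have e: "norm e > 0" using w by (auto simp: w1_def u_def)
  \<comment> \<open>By Cauchy-Schwarz the coordinate on this ball does not exceed
    \<open>|w1|\<close> or \<open>|w2|\<close>, so it stays in the range swept by the trajectory on
    its side.\<close>
  define r' where "r' = min r (min \<bar>w1\<bar> \<bar>w2\<bar> / norm e)"
  show thesis
  proof (rule that[of r'])
    show "r' > 0" using r w e by (simp add: r'_def)
    fix \<gamma> assume \<gamma>: "backward_orbit \<gamma>" "\<And>T. T \<ge> 0 \<Longrightarrow> \<gamma> T \<in> cball c r'"
    have in_r: "\<gamma> T \<in> cball c r" if "T \<ge> 0" for T using \<gamma>(2)[OF that] by (simp add: r'_def)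
    define v where "v = u (\<gamma> 0)"
    have "\<bar>v\<bar> \<le> norm e * norm (\<gamma> 0 - c)" unfolding v_def u_def by (rule Cauchy_Schwarz_ineq2)
    also have "\<dots> \<le> norm e * (min \<bar>w1\<bar> \<bar>w2\<bar> / norm e)"
      using \<gamma>(2)[of 0] by (intro mult_left_mono) (auto simp: r'_def dist_norm norm_minus_commute)
    finally have v_le: "\<bar>v\<bar> \<le> \<bar>w1\<bar>" "\<bar>v\<bar> \<le> \<bar>w2\<bar>" using e by auto
    consider "v = 0" | "0 < v / w1" | "0 < v / w2"
      using opp by (fastforce simp: zero_less_divide_iff mult_less_0_iff)
    then show "\<gamma> 0 \<in> insert c (range g1 \<union> range g2)"
    proof cases
      case 1
      then have "\<gamma> 0 = c"
        using u_eq[OF \<gamma>(1) backward_orbit_critical[OF c] in_r] r by (simp add: v_def u_def)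
      then show ?thesis by simp
    next
      case 2
      then have "v / w1 \<le> 1" using v_le by (auto simp: zero_less_divide_iff divide_le_eq)
      with 2 obtain t where t: "t \<le> t0" "u (g1 t) = v" using sweep[OF g(1) lim(1)] by (auto simp: w1_def)
      have "\<gamma> 0 = g1 (t - 0)"
        using t t0 by (intro u_eq \<gamma>(1) in_r backward_orbit_entire_solution g) (auto simp: v_def)
      then show ?thesis by simp
    next
      case 3
      then have "v / w2 \<le> 1" using v_le by (auto simp: zero_less_divide_iff divide_le_eq)
      with 3 obtain t where t: "t \<le> t0" "u (g2 t) = v" using sweep[OF g(2) lim(2)] by (auto simp: w2_def)
      have "\<gamma> 0 = g2 (t - 0)"
        using t t0 by (intro u_eq \<gamma>(1) in_r backward_orbit_entire_solution g) (auto simp: v_def)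
      then show ?thesis by simp
    qed
  qed
qed

end

text \<open>Nondegeneracy bounds the Hessian below by some \<open>k\<close>, and a ball with
  linearization error \<open>k / 2\<close> meets the hypotheses of
  \<open>backward_orbits_eq\<close>. The lemma stands outside the locale because
  \<open>hessian\<close> is defined on \<open>real^'n\<close> and the locale on a general Euclidean
  space.\<close>

lemma backward_orbits_eq_near_nondegenerate:
  fixes V :: "real^'n \<Rightarrow> real"
  assumes "lipschitz_gradient_flow V (grad V) L S" and V: "times_continuously_differentiable 3 V"
    and nondeg: "\<And>v. hessian V c *v v = 0 \<Longrightarrow> v = 0"
  obtains r where "r > 0" "\<And>\<gamma> \<delta>. lipschitz_gradient_flow.backward_orbit S \<gamma> \<Longrightarrow>
    lipschitz_gradient_flow.backward_orbit S \<delta> \<Longrightarrow>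
    (\<And>T. T \<ge> 0 \<Longrightarrow> \<gamma> T \<in> cball c r) \<Longrightarrow> (\<And>T. T \<ge> 0 \<Longrightarrow> \<delta> T \<in> cball c r) \<Longrightarrow>
    (\<gamma> 0 - \<delta> 0) \<bullet> (hessian V c *v (\<gamma> 0 - \<delta> 0)) \<ge> 0 \<Longrightarrow> \<gamma> 0 = \<delta> 0"
proof -
  interpret lipschitz_gradient_flow V "grad V" L S by fact
  obtain k where k: "k > 0" "\<And>v. k * norm v \<le> norm (hessian V c *v v)"
    using matrix_bounded_below[OF nondeg] by metis
  obtain r where r: "r > 0" "\<And>x y. x \<in> cball c r \<Longrightarrow> y \<in> cball c r \<Longrightarrow>
    norm (grad V x - grad V y - hessian V c *v (x - y)) \<le> k / 2 * norm (x - y)"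
    using grad_linearization[OF V, of "k / 2" c] k(1) by auto
  show thesis
  proof (rule that[OF r(1)])
    fix \<gamma> \<delta>
    assume orb: "backward_orbit \<gamma>" "backward_orbit \<delta>"
      "\<And>T. T \<ge> 0 \<Longrightarrow> \<gamma> T \<in> cball c r" "\<And>T. T \<ge> 0 \<Longrightarrow> \<delta> T \<in> cball c r"
      "(\<gamma> 0 - \<delta> 0) \<bullet> (hessian V c *v (\<gamma> 0 - \<delta> 0)) \<ge> 0"
    show "\<gamma> 0 = \<delta> 0"
      by (rule backward_orbits_eq[where c = c and r = r, OF matrix_vector_mul_bounded_linear
            symmetric_matrix_inner[OF transpose_hessian[OF V]] k])
        (fact r(2) orb)+
  qed
qed

subsection \<open>Stability of minimum energy paths\<close>

lemma breakpoints_cover: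
  fixes \<tau> :: "nat \<Rightarrow> real"
  assumes "1 \<le> j" "x \<in> {\<tau> 1..\<tau> j}" "x < \<tau> j"
  shows "\<exists>i\<in>{1..<j}. \<tau> i \<le> x \<and> x < \<tau> (Suc i)"
  using assms
proof (induction j rule: dec_induct)
  case (step n)
  show ?case
  proof (cases "x < \<tau> n")
    case True
    with step show ?thesis by (auto intro: less_SucI)
  next
    case False
    with step show ?thesis by (intro bexI[of _ n]) auto
  qed
qed auto

lemma breakpoints_mono:
  fixes \<tau> :: "nat \<Rightarrow> real"
  assumes "\<And>i. i \<in> {1..<k} \<Longrightarrow> \<tau> i \<le> \<tau> (Suc i)" "1 \<le> i" "i \<le> j" "j \<le> k"
  shows "\<tau> i \<le> \<tau> j"
  using assms(3,4)
proof (induction j rule: dec_induct)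
  case (step n)
  then show ?case using assms(1)[of n] assms(2) by auto
qed simp

text \<open>Each point of \<open>C\<close> has an open set meeting \<open>Z\<close> in that point
  alone, so removing \<open>C\<close> from \<open>Z\<close> amounts to removing an open set. This
  keeps the other critical points at a distance from the path.\<close>

lemma closed_critical_remainder:
  fixes C Z :: "'a::metric_space set"
  assumes "closed Z" "\<And>x. x \<in> C \<Longrightarrow> x isolated_in Z"
  shows "closed (Z - C)"
proof -
  have "\<exists>T. open T \<and> T \<inter> Z = {x}" if "x \<in> C" for x
    using assms(2)[OF that] by (auto simp: isolated_in_def)
  then obtain T where T: "\<And>x. x \<in> C \<Longrightarrow> open (T x) \<and> T x \<inter> Z = {x}" by metis
  have "y \<in> C" if "x \<in> C" "y \<in> T x" "y \<in> Z" for x y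
    using T[OF that(1)] that by auto
  moreover have "x \<in> T x" if "x \<in> C" for x using T[OF that] by auto
  ultimately have "Z - C = Z - (\<Union>x\<in>C. T x)" by auto
  with T assms(1) show ?thesis by (auto intro!: closed_Diff open_UN)
qed

lemma gradient_flow_locale:
  fixes V :: "real^'n \<Rightarrow> real"
  assumes "\<And>x. V differentiable (at x)" "L-lipschitz_on UNIV (grad V)" "gradient_flow V S"
  shows "lipschitz_gradient_flow V (grad V) L S"
  using assms by unfold_locales (auto simp: gradient_flow_def intro: grad_has_derivative)

section \<open>Curves near an invariant arc\<close>

context lipschitz_gradient_flow
begin

lemma
  fixes \<phi> :: "real \<Rightarrow> 'a" and a b :: real
  defines "M \<equiv> \<phi> ` {a..b}"
  assumes \<phi>: "a \<le> b" "continuous_on {a..b} \<phi>" "inj_on \<phi> {a..b}"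
    and ends: "G (\<phi> a) = 0" "G (\<phi> b) = 0"
    and inv: "\<And>x t. x \<in> M \<Longrightarrow> t \<ge> 0 \<Longrightarrow> S t x \<in> M"
    and N: "compact N" "M \<subseteq> interior N"
    and orb: "\<And>\<gamma>. backward_orbit \<gamma> \<Longrightarrow> (\<And>T. T \<ge> 0 \<Longrightarrow> \<gamma> T \<in> N) \<Longrightarrow> \<gamma> 0 \<in> M"
  shows stable_arc: "\<And>e. e > 0 \<Longrightarrow> \<exists>d>0. \<forall>\<Gamma> t. connected \<Gamma> \<longrightarrow> \<phi> a \<in> \<Gamma> \<longrightarrow> \<phi> b \<in> \<Gamma> \<longrightarrow>
      (\<forall>x\<in>\<Gamma>. infdist x M \<le> d) \<longrightarrow> t \<ge> 0 \<longrightarrow>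
      (\<forall>x\<in>S t ` \<Gamma>. infdist x M \<le> e) \<and> (\<forall>x\<in>M. infdist x (S t ` \<Gamma>) \<le> e)"
    and attracting_arc: "\<exists>d>0. \<forall>e>0. \<exists>T\<ge>0. \<forall>\<Gamma> t. connected \<Gamma> \<longrightarrow> \<phi> a \<in> \<Gamma> \<longrightarrow> \<phi> b \<in> \<Gamma> \<longrightarrow>
      (\<forall>x\<in>\<Gamma>. infdist x M \<le> d) \<longrightarrow> t > T \<longrightarrow>
      (\<forall>x\<in>S t ` \<Gamma>. infdist x M \<le> e) \<and> (\<forall>x\<in>M. infdist x (S t ` \<Gamma>) \<le> e)"
proof -
  have M: "compact M" "M \<noteq> {}"
    using \<phi> by (auto simp: M_def intro: compact_continuous_image)
  have infdist_open: "open {x. infdist x M < d}" for d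
    by (intro open_Collect_less continuous_intros)
  \<comment> \<open>The tolerance \<open>\<eta>\<close> depends on \<open>e\<close> alone, not on
    \<open>t\<close>: every image of \<open>\<Gamma>\<close> under \<open>S t\<close> is connected
    and still contains the ends of the arc, which are critical and hence fixed.\<close>
  have cover: "\<exists>\<eta>>0. \<forall>\<Gamma> t. connected \<Gamma> \<longrightarrow> \<phi> a \<in> \<Gamma> \<longrightarrow> \<phi> b \<in> \<Gamma> \<longrightarrow> t \<ge> 0 \<longrightarrow>
      (\<forall>x\<in>S t ` \<Gamma>. infdist x M \<le> \<eta>) \<longrightarrow> (\<forall>x\<in>M. infdist x (S t ` \<Gamma>) \<le> e)" if e: "e > 0" for e
  proof -
    obtain \<eta> where \<eta>: "\<eta> > 0" "\<And>\<Gamma> p. connected \<Gamma> \<Longrightarrow> \<phi> a \<in> \<Gamma> \<Longrightarrow> \<phi> b \<in> \<Gamma> \<Longrightarrow>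
      (\<And>x. x \<in> \<Gamma> \<Longrightarrow> infdist x M \<le> \<eta>) \<Longrightarrow> p \<in> M \<Longrightarrow> infdist p \<Gamma> \<le> e"
      using arc_near_connecting_set[OF \<phi>(2,3) e] unfolding M_def by blast
    have "\<forall>x\<in>M. infdist x (S t ` \<Gamma>) \<le> e"
      if "connected \<Gamma>" "\<phi> a \<in> \<Gamma>" "\<phi> b \<in> \<Gamma>" "t \<ge> 0" "\<forall>x\<in>S t ` \<Gamma>. infdist x M \<le> \<eta>" for \<Gamma> t
    proof
      fix x assume "x \<in> M"
      then show "infdist x (S t ` \<Gamma>) \<le> e"
      proof (rule \<eta>(2)[rotated 4])
        show "connected (S t ` \<Gamma>)"
          using that by (intro connected_continuous_image continuous_on_flow)
        show "\<phi> a \<in> S t ` \<Gamma>" "\<phi> b \<in> S t ` \<Gamma>"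
          using that flow_critical[OF ends(1), of t] flow_critical[OF ends(2), of t]
          by (metis imageI)+
      qed (use that(5) in blast)
    qed
    with \<eta>(1) show ?thesis by blast
  qed
  show "\<exists>d>0. \<forall>\<Gamma> t. connected \<Gamma> \<longrightarrow> \<phi> a \<in> \<Gamma> \<longrightarrow> \<phi> b \<in> \<Gamma> \<longrightarrow>
      (\<forall>x\<in>\<Gamma>. infdist x M \<le> d) \<longrightarrow> t \<ge> 0 \<longrightarrow>
      (\<forall>x\<in>S t ` \<Gamma>. infdist x M \<le> e) \<and> (\<forall>x\<in>M. infdist x (S t ` \<Gamma>) \<le> e)" if e: "e > 0" for e
  proof -
    obtain \<eta> where \<eta>: "\<eta> > 0" "\<And>\<Gamma> t. connected \<Gamma> \<Longrightarrow> \<phi> a \<in> \<Gamma> \<Longrightarrow> \<phi> b \<in> \<Gamma> \<Longrightarrow> t \<ge> 0 \<Longrightarrow>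
      \<forall>x\<in>S t ` \<Gamma>. infdist x M \<le> \<eta> \<Longrightarrow> \<forall>x\<in>M. infdist x (S t ` \<Gamma>) \<le> e"
      using cover[OF e] by blast
    \<comment> \<open>Trapping is applied to a smaller neighbourhood whose points already meet both
      tolerances; a backward orbit in \<open>N'\<close> is one in \<open>N\<close>, so
      \<open>orb\<close> carries over.\<close>
    define N' where "N' = N \<inter> {x. infdist x M \<le> min e \<eta>}"
    have "closed {x. infdist x M \<le> min e \<eta>}" by (intro closed_Collect_le continuous_intros)
    with N(1) have N': "compact N'" unfolding N'_def by (rule compact_Int_closed)
    have "M \<subseteq> interior N'"
    proof -
      have "M \<subseteq> interior N \<inter> {x. infdist x M < min e \<eta>}"
        using N(2) e \<eta>(1) by auto
      also have "\<dots> \<subseteq> interior N'"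
      proof (rule interior_maximal)
        show "interior N \<inter> {x. infdist x M < min e \<eta>} \<subseteq> N'"
          using interior_subset by (auto simp: N'_def)
      qed (intro open_Int open_interior infdist_open)
      finally show ?thesis .
    qed
    then obtain d where d: "d > 0" "\<And>x t. infdist x M \<le> d \<Longrightarrow> t \<ge> 0 \<Longrightarrow> S t x \<in> N'"
      by (rule trapped_near_invariant_set[OF N' _ M _ inv, rotated]) (use orb in \<open>auto simp: N'_def\<close>)
    have "(\<forall>x\<in>S t ` \<Gamma>. infdist x M \<le> e) \<and> (\<forall>x\<in>M. infdist x (S t ` \<Gamma>) \<le> e)"
      if "connected \<Gamma>" "\<phi> a \<in> \<Gamma>" "\<phi> b \<in> \<Gamma>" "\<forall>x\<in>\<Gamma>. infdist x M \<le> d" "t \<ge> 0" for \<Gamma> t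
    proof -
      have "\<forall>x\<in>S t ` \<Gamma>. infdist x M \<le> min e \<eta>"
        using d(2) that(4,5) by (fastforce simp: N'_def)
      with \<eta>(2)[OF that(1,2,3,5)] show ?thesis by auto
    qed
    with d(1) show ?thesis by blast
  qed
  \<comment> \<open>This \<open>d\<close> comes from \<open>N\<close> alone, so one basin serves
    every \<open>e\<close>; only the time \<open>T\<close> below depends on
    \<open>e\<close>.\<close>
  obtain d where d: "d > 0" "\<And>x t. infdist x M \<le> d \<Longrightarrow> t \<ge> 0 \<Longrightarrow> S t x \<in> N"
    by (rule trapped_near_invariant_set[of N M]) (use N orb M inv in blast)+
  have "\<exists>T\<ge>0. \<forall>\<Gamma> t. connected \<Gamma> \<longrightarrow> \<phi> a \<in> \<Gamma> \<longrightarrow> \<phi> b \<in> \<Gamma> \<longrightarrow>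
      (\<forall>x\<in>\<Gamma>. infdist x M \<le> d) \<longrightarrow> t > T \<longrightarrow>
      (\<forall>x\<in>S t ` \<Gamma>. infdist x M \<le> e) \<and> (\<forall>x\<in>M. infdist x (S t ` \<Gamma>) \<le> e)" if e: "e > 0" for e
  proof -
    obtain \<eta> where \<eta>: "\<eta> > 0" "\<And>\<Gamma> t. connected \<Gamma> \<Longrightarrow> \<phi> a \<in> \<Gamma> \<Longrightarrow> \<phi> b \<in> \<Gamma> \<Longrightarrow> t \<ge> 0 \<Longrightarrow>
      \<forall>x\<in>S t ` \<Gamma>. infdist x M \<le> \<eta> \<Longrightarrow> \<forall>x\<in>M. infdist x (S t ` \<Gamma>) \<le> e"
      using cover[OF e] by blast
    have "M \<subseteq> {x. infdist x M < min e \<eta>}" using e \<eta>(1) by auto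
    then obtain T where T: "T \<ge> 0" "\<And>x. (\<And>s. 0 \<le> s \<Longrightarrow> s \<le> T \<Longrightarrow> S s x \<in> N) \<Longrightarrow>
        S T x \<in> {x. infdist x M < min e \<eta>}"
      by (rule long_orbit_ends_near[of N M, rotated 3]) (use N orb infdist_open in blast)+
    have "(\<forall>x\<in>S t ` \<Gamma>. infdist x M \<le> e) \<and> (\<forall>x\<in>M. infdist x (S t ` \<Gamma>) \<le> e)"
      if "connected \<Gamma>" "\<phi> a \<in> \<Gamma>" "\<phi> b \<in> \<Gamma>" "\<forall>x\<in>\<Gamma>. infdist x M \<le> d" "t > T" for \<Gamma> t
    proof -
      have "infdist (S t x) M < min e \<eta>" if x: "x \<in> \<Gamma>" for x
      proof -
        \<comment> \<open>The orbit never leaves \<open>N\<close>, so the last \<open>T\<close> time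
          units before \<open>t\<close> form a stay in \<open>N\<close>.\<close>
        have "S s (S (t - T) x) \<in> N" if "0 \<le> s" "s \<le> T" for s
          using flow_add[of s "t - T" x] d(2)[of x "s + (t - T)"] x that \<open>t > T\<close>
            \<open>\<forall>x\<in>\<Gamma>. infdist x M \<le> d\<close> by auto
        from T(2)[OF this] show ?thesis using flow_add[of T "t - T" x] T(1) \<open>t > T\<close> by simp
      qed
      then have near: "\<forall>x\<in>S t ` \<Gamma>. infdist x M \<le> min e \<eta>" by (auto simp: less_imp_le)
      have "t \<ge> 0" using T(1) that(5) by simp
      from near \<eta>(2)[OF that(1,2,3) this] show ?thesis by auto
    qed
    with T(1) show ?thesis by blast
  qed
  with d(1) show "\<exists>d>0. \<forall>e>0. \<exists>T\<ge>0. \<forall>\<Gamma> t. connected \<Gamma> \<longrightarrow> \<phi> a \<in> \<Gamma> \<longrightarrow> \<phi> b \<in> \<Gamma> \<longrightarrow>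
      (\<forall>x\<in>\<Gamma>. infdist x M \<le> d) \<longrightarrow> t > T \<longrightarrow>
      (\<forall>x\<in>S t ` \<Gamma>. infdist x M \<le> e) \<and> (\<forall>x\<in>M. infdist x (S t ` \<Gamma>) \<le> e)" by blast
qed

end

lemma curvesD:
  assumes "\<Gamma> \<in> curves p q"
  shows "compact \<Gamma>" "connected \<Gamma>" "p \<in> \<Gamma>" "q \<in> \<Gamma>"
  using assms
  by (auto simp: curves_def intro: compact_path_image connected_path_image)

theorem theorem3p12:
  fixes V :: "real^'n \<Rightarrow> real"
    and S :: "real \<Rightarrow> real^'n \<Rightarrow> real^'n"
    and L C3 a b :: real
    and \<phi> :: "real \<Rightarrow> real^'n"
    and M :: "(real^'n) set"
    and k :: nat
    and m s :: "nat \<Rightarrow> real^'n"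
  assumes V_C3: "times_continuously_differentiable 3 V"
    and L_pos: "L > 0"
    and grad_Lipschitz: "L-lipschitz_on UNIV (grad V)"
    and C3_pos: "C3 > 0"
    and third_bound:
      "\<And>x i j l. \<bar>partial_deriv i (partial_deriv j (partial_deriv l V)) x\<bar> \<le> C3"
    and flow: "gradient_flow V S"
    and k: "k \<ge> 2"
    and MEP: "minimum_energy_path V (m 1) (m k) a b \<phi>"
    and M_def: "M = \<phi> ` {a..b}"
    and no_self_intersection: "inj_on \<phi> {a..b}"
    and in_order: "passes_in_order V a b \<phi> k m s"
    and minima: "\<And>i. i \<in> {1..k} \<Longrightarrow> local_minimum V (m i)"
    and saddles: "\<And>i. i \<in> {1..<k} \<Longrightarrow> saddle V (s i)"
    and minima_nondegenerate: "\<And>i. i \<in> {1..k} \<Longrightarrow> positive_definite (hessian V (m i))"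
    and distinct_minima: "inj_on m {1..k}"
    and distinct_saddles: "inj_on s {1..<k}"
    and distinct_minima_saddles: "m ` {1..k} \<inter> s ` {1..<k} = {}"
    and isolated: "\<And>x. x \<in> m ` {1..k} \<union> s ` {1..<k} \<Longrightarrow> x isolated_in critical_points V"
    and no_others: "M \<inter> critical_points V = m ` {1..k} \<union> s ` {1..<k}"
  shows "uniformly_stable S (m 1) (m k) M \<and>
    (\<exists>B U. compact B \<and> open U \<and> M \<subseteq> U \<and> U \<subseteq> B \<and>
       asymptotically_stable_on S (m 1) (m k) M B)"
proof -
  note V_diff = times_continuously_differentiable_imp[OF V_C3]
  interpret lipschitz_gradient_flow V "grad V" L S
    by (rule gradient_flow_locale) (fact V_diff grad_Lipschitz flow)+
  define C where "C = m ` {1..k} \<union> s ` {1..<k}"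
  have C: "finite C" "C \<subseteq> M" "\<And>c. c \<in> C \<Longrightarrow> grad V c = 0"
    using no_others by (auto simp: C_def critical_points_def)
  have \<phi>: "a \<le> b" "continuous_on {a..b} \<phi>" "\<phi> a = m 1" "\<phi> b = m k"
    using MEP by (auto simp: minimum_energy_path_def)
  have M: "compact M" "M \<noteq> {}"
    using \<phi> by (auto simp: M_def intro: compact_continuous_image)
  obtain \<tau> \<sigma> where \<tau>: "\<tau> 1 = a" "\<tau> k = b" "\<And>i. i \<in> {1..k} \<Longrightarrow> \<phi> (\<tau> i) = m i"
    and \<sigma>: "\<And>i. i \<in> {1..<k} \<Longrightarrow> \<phi> (\<sigma> i) = s i" "\<And>i. i \<in> {1..<k} \<Longrightarrow> \<tau> i < \<sigma> i"
      "\<And>i. i \<in> {1..<k} \<Longrightarrow> \<sigma> i < \<tau> (Suc i)"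
    and traj: "\<And>i. i \<in> {1..<k} \<Longrightarrow> heteroclinic_trajectory V (s i) (m i) (\<phi> ` {\<tau> i<..<\<sigma> i})"
      "\<And>i. i \<in> {1..<k} \<Longrightarrow> heteroclinic_trajectory V (s i) (m (Suc i)) (\<phi> ` {\<sigma> i<..<\<tau> (Suc i)})"
    using in_order unfolding passes_in_order_def by blast
  have step: "\<tau> i \<le> \<tau> (Suc i)" if "i \<in> {1..<k}" for i
    using \<sigma>(2,3)[OF that] by simp
  have \<tau>_ab: "\<tau> i \<in> {a..b}" if "i \<in> {1..k}" for i
    using breakpoints_mono[of k \<tau> 1 i] breakpoints_mono[of k \<tau> i k] step that \<tau>(1,2) by auto
  have sub: "{\<tau> i..\<tau> (Suc i)} \<subseteq> {a..b}" if "i \<in> {1..<k}" for i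
    using \<tau>_ab[of i] \<tau>_ab[of "Suc i"] that by auto
  \<comment> \<open>A noncritical point of \<open>M\<close> has a parameter strictly between two
    neighbouring critical ones, so it lies on a heteroclinic trajectory whose entire range is a
    piece of \<open>M\<close>.\<close>
  have inv: "S t x \<in> M" if x: "x \<in> M" and t: "t \<ge> 0" for x t
  proof (cases "x \<in> C")
    case True
    then show ?thesis using flow_critical[OF C(3) t] x by simp
  next
    case False
    obtain \<alpha> where \<alpha>: "\<alpha> \<in> {a..b}" "x = \<phi> \<alpha>" using x by (auto simp: M_def)
    have not_b: "\<alpha> \<noteq> b" using False \<alpha>(2) \<phi>(4) k by (auto simp: C_def)
    obtain i where i: "i \<in> {1..<k}" "\<tau> i \<le> \<alpha>" "\<alpha> < \<tau> (Suc i)"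
      using breakpoints_cover[of k \<alpha> \<tau>] \<alpha>(1) not_b \<tau>(1,2) k by auto
    have "\<alpha> \<noteq> \<tau> i" "\<alpha> \<noteq> \<sigma> i"
      using False \<alpha>(2) \<tau>(3)[of i] \<sigma>(1)[of i] i(1) by (auto simp: C_def)
    then have "\<alpha> \<in> {\<tau> i<..<\<sigma> i} \<or> \<alpha> \<in> {\<sigma> i<..<\<tau> (Suc i)}" using i by auto
    then obtain q I where I: "heteroclinic_trajectory V (s i) q (\<phi> ` I)" "\<alpha> \<in> I" "I \<subseteq> {\<tau> i..\<tau> (Suc i)}"
      using traj[OF i(1)] \<sigma>(2,3)[OF i(1)] by fastforce
    then obtain g where g: "\<And>t. (g has_vector_derivative - grad V (g t)) (at t)" "\<phi> ` I = range g"
      unfolding heteroclinic_trajectory_def by metis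
    with I(2) \<alpha>(2) obtain u where "x = g u" by blast
    then have "S t x \<in> \<phi> ` I" using flow_entire_solution[OF g(1) t] g(2) by simp
    with I(3) sub[OF i(1)] show ?thesis unfolding M_def by blast
  qed
  have local: "\<exists>r>0. \<forall>\<gamma>. backward_orbit \<gamma> \<longrightarrow> (\<forall>T\<ge>0. \<gamma> T \<in> cball c r) \<longrightarrow> \<gamma> 0 \<in> M"
    if c: "c \<in> C" for c
  proof (cases "c \<in> m ` {1..k}")
    case True
    then have pd: "positive_definite (hessian V c)" using minima_nondegenerate by auto
    then have "v = 0" if "hessian V c *v v = 0" for v
      using that unfolding positive_definite_def by (metis inner_zero_right less_irrefl)
    from backward_orbits_eq_near_nondegenerate[OF lipschitz_gradient_flow_axioms V_C3 this]
    obtain r where r: "r > 0" "\<And>\<gamma> \<delta>. backward_orbit \<gamma> \<Longrightarrow> backward_orbit \<delta> \<Longrightarrow>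
      (\<And>T. T \<ge> 0 \<Longrightarrow> \<gamma> T \<in> cball c r) \<Longrightarrow> (\<And>T. T \<ge> 0 \<Longrightarrow> \<delta> T \<in> cball c r) \<Longrightarrow>
      (\<gamma> 0 - \<delta> 0) \<bullet> (hessian V c *v (\<gamma> 0 - \<delta> 0)) \<ge> 0 \<Longrightarrow> \<gamma> 0 = \<delta> 0" by metis
    have "\<gamma> 0 \<in> M" if \<gamma>: "backward_orbit \<gamma>" "\<forall>T\<ge>0. \<gamma> T \<in> cball c r" for \<gamma>
    proof -
      have "v \<bullet> (hessian V c *v v) \<ge> 0" for v
        using pd unfolding positive_definite_def by (cases "v = 0") (auto simp: less_imp_le)
      then have "\<gamma> 0 = c"
        using \<gamma> r(1) by (intro r(2)[OF _ backward_orbit_critical[OF C(3)[OF c]]]) auto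
      with c C(2) show ?thesis by blast
    qed
    with r(1) show ?thesis by blast
  next
    case False
    then obtain i where i: "i \<in> {1..<k}" "c = s i" using c by (auto simp: C_def)
    have H: "one_negative_others_positive (hessian V c)"
      using saddles[OF i(1)] i(2) by (simp add: saddle_def)
    \<comment> \<open>The condition \<open>e \<bullet> (\<gamma> 0 - \<delta> 0) = 0\<close> thus
      implies the sign condition of the uniqueness criterion, which makes \<open>e\<close> the
      coordinate that separates local backward orbits.\<close>
    obtain e where e: "\<And>w. e \<bullet> w = 0 \<Longrightarrow> w \<bullet> (hessian V c *v w) \<ge> 0"
      using one_negative_nonneg_on_complement[OF transpose_hessian[OF V_C3] H] by blast
    from backward_orbits_eq_near_nondegenerate[OF lipschitz_gradient_flow_axioms V_C3
      one_negative_nondegenerate[OF H]]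
    obtain r where r: "r > 0" "\<And>\<gamma> \<delta>. backward_orbit \<gamma> \<Longrightarrow> backward_orbit \<delta> \<Longrightarrow>
      (\<And>T. T \<ge> 0 \<Longrightarrow> \<gamma> T \<in> cball c r) \<Longrightarrow> (\<And>T. T \<ge> 0 \<Longrightarrow> \<delta> T \<in> cball c r) \<Longrightarrow>
      (\<gamma> 0 - \<delta> 0) \<bullet> (hessian V c *v (\<gamma> 0 - \<delta> 0)) \<ge> 0 \<Longrightarrow> \<gamma> 0 = \<delta> 0" by metis
    obtain g1 where g1: "\<And>t. (g1 has_vector_derivative - grad V (g1 t)) (at t)"
      "(g1 \<longlongrightarrow> c) at_bot" "range g1 = \<phi> ` {\<tau> i<..<\<sigma> i}"
      using traj(1)[OF i(1)] i(2) unfolding heteroclinic_trajectory_def by metis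
    obtain g2 where g2: "\<And>t. (g2 has_vector_derivative - grad V (g2 t)) (at t)"
      "(g2 \<longlongrightarrow> c) at_bot" "range g2 = \<phi> ` {\<sigma> i<..<\<tau> (Suc i)}"
      using traj(2)[OF i(1)] i(2) unfolding heteroclinic_trajectory_def by metis
    \<comment> \<open>Injectivity of \<open>\<phi>\<close> turns disjointness of parameter sets into
      disjointness of the saddle and its two trajectories.\<close>
    have img: "\<phi> x \<in> \<phi> ` A \<longleftrightarrow> x \<in> A" if "x \<in> {a..b}" "A \<subseteq> {a..b}" for x A
      using inj_on_image_mem_iff[OF no_self_intersection that] .
    have c_eq: "c = \<phi> (\<sigma> i)" using \<sigma>(1) i by simp
    have ivl: "\<sigma> i \<in> {a..b}" "{\<tau> i<..<\<sigma> i} \<subseteq> {a..b}" "{\<sigma> i<..<\<tau> (Suc i)} \<subseteq> {a..b}"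
      using sub[OF i(1)] \<sigma>(2,3)[OF i(1)] by auto
    have disj: "c \<notin> range g1" "c \<notin> range g2" "range g1 \<inter> range g2 = {}"
      unfolding g1(3) g2(3) c_eq img[OF ivl(1,2)] img[OF ivl(1,3)]
        inj_on_image_Int[OF no_self_intersection ivl(2,3), symmetric] by auto
    obtain r' where r': "r' > 0" "\<And>\<gamma>. backward_orbit \<gamma> \<Longrightarrow> (\<And>T. T \<ge> 0 \<Longrightarrow> \<gamma> T \<in> cball c r') \<Longrightarrow>
        \<gamma> 0 \<in> insert c (range g1 \<union> range g2)"
    proof (rule backward_orbit_in_two_trajectories[of c r e g1 g2])
      show "\<gamma> 0 = \<delta> 0" if "backward_orbit \<gamma>" "backward_orbit \<delta>"
        "\<And>T. T \<ge> 0 \<Longrightarrow> \<gamma> T \<in> cball c r" "\<And>T. T \<ge> 0 \<Longrightarrow> \<delta> T \<in> cball c r"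
        "e \<bullet> (\<gamma> 0 - \<delta> 0) = 0" for \<gamma> \<delta>
        by (rule r(2)[OF that(1-4) e[OF that(5)]])
    qed (use r(1) C(3)[OF c] g1 g2 disj in blast)+
    have "insert c (range g1 \<union> range g2) \<subseteq> M"
      using c C(2) ivl(2,3) unfolding g1(3) g2(3) M_def by blast
    with r' show ?thesis by blast
  qed
  have "continuous_on UNIV (grad V)" by (rule lipschitz_on_continuous_on[OF grad_Lipschitz])
  then have "closed (critical_points V)"
    unfolding critical_points_def by (intro closed_Collect_eq continuous_intros)
  then have "open (- (critical_points V - C))"
    using isolated by (intro open_Compl closed_critical_remainder) (auto simp: C_def)
  moreover have "M \<subseteq> - (critical_points V - C)" using no_others by (auto simp: C_def)
  ultimately obtain d0 where d0: "d0 > 0" "\<And>x. infdist x M \<le> d0 \<Longrightarrow> x \<notin> critical_points V - C"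
    using compact_infdist_subset_open[OF M] by (metis ComplD)
  define N where "N = {x. infdist x M \<le> d0}"
  have N: "compact N" unfolding N_def using M d0(1) by (intro compact_infdist_le) auto
  have "M \<subseteq> {x. infdist x M < d0}" using d0(1) by auto
  also have "\<dots> \<subseteq> interior N"
    by (intro interior_maximal open_Collect_less continuous_intros) (auto simp: N_def)
  finally have MN: "M \<subseteq> interior N" .
  have NC: "{x \<in> N. grad V x = 0} \<subseteq> C" using d0(2) by (auto simp: N_def critical_points_def)
  have orb: "\<gamma> 0 \<in> M" if \<gamma>: "backward_orbit \<gamma>" "\<And>T. T \<ge> 0 \<Longrightarrow> \<gamma> T \<in> N" for \<gamma>
  proof -
    obtain r where r: "\<And>c. c \<in> C \<Longrightarrow> r c > 0" "\<And>c \<gamma>. c \<in> C \<Longrightarrow> backward_orbit \<gamma> \<Longrightarrow>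
      \<forall>T\<ge>0. \<gamma> T \<in> cball c (r c) \<Longrightarrow> \<gamma> 0 \<in> M" using local by metis
    obtain c T where c: "c \<in> C" "T \<ge> 0" "\<And>t. t \<ge> T \<Longrightarrow> \<gamma> t \<in> cball c (r c)"
      by (rule backward_orbit_eventually_near_critical[of N C \<gamma> r]) (use N C(1) NC \<gamma> r(1) in blast)+
    \<comment> \<open>The local result applies to the orbit shifted by \<open>T\<close>; forward
      invariance of \<open>M\<close> then leads from \<open>\<gamma> T\<close> to
      \<open>\<gamma> 0\<close>.\<close>
    have "\<gamma> (0 + T) \<in> M"
      by (rule r(2)[OF c(1) backward_orbit_shift[OF \<gamma>(1) c(2)]]) (use c(3) in auto)
    then show ?thesis using inv[of "\<gamma> T" T] backward_orbitD[OF \<gamma>(1) c(2) order_refl] c(2) by simp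
  qed
  have ends: "grad V (\<phi> a) = 0" "grad V (\<phi> b) = 0"
    using C(3) \<phi>(3,4) k by (auto simp: C_def)
  have hausdorff: "hausdorff_dist M (S t ` \<Gamma>) \<le> e"
    if "\<Gamma> \<in> curves (m 1) (m k)" "(\<forall>x\<in>S t ` \<Gamma>. infdist x M \<le> e) \<and> (\<forall>x\<in>M. infdist x (S t ` \<Gamma>) \<le> e)"
    for \<Gamma> t e
    using that curvesD[OF that(1)] M(2) unfolding hausdorff_dist_def
    by (auto intro!: max.boundedI one_sided_dist_le)
  have stable: "\<exists>d>0. \<forall>\<Gamma> t. connected \<Gamma> \<longrightarrow> \<phi> a \<in> \<Gamma> \<longrightarrow> \<phi> b \<in> \<Gamma> \<longrightarrow>
      (\<forall>x\<in>\<Gamma>. infdist x M \<le> d) \<longrightarrow> t \<ge> 0 \<longrightarrow>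
      (\<forall>x\<in>S t ` \<Gamma>. infdist x M \<le> e) \<and> (\<forall>x\<in>M. infdist x (S t ` \<Gamma>) \<le> e)" if "e > 0" for e
    by (rule stable_arc[of a b \<phi> N e, folded M_def])
      (fact \<phi>(1,2) no_self_intersection ends inv N MN orb that)+
  have attracting: "\<exists>d>0. \<forall>e>0. \<exists>T\<ge>0. \<forall>\<Gamma> t. connected \<Gamma> \<longrightarrow> \<phi> a \<in> \<Gamma> \<longrightarrow> \<phi> b \<in> \<Gamma> \<longrightarrow>
      (\<forall>x\<in>\<Gamma>. infdist x M \<le> d) \<longrightarrow> t > T \<longrightarrow>
      (\<forall>x\<in>S t ` \<Gamma>. infdist x M \<le> e) \<and> (\<forall>x\<in>M. infdist x (S t ` \<Gamma>) \<le> e)"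
    by (rule attracting_arc[of a b \<phi> N, folded M_def])
      (fact \<phi>(1,2) no_self_intersection ends inv N MN orb)+
  have "uniformly_stable S (m 1) (m k) M"
    unfolding uniformly_stable_def
  proof (intro allI impI)
    fix e :: real assume e: "e > 0"
    obtain d where d: "d > 0" "\<And>\<Gamma> t. connected \<Gamma> \<Longrightarrow> \<phi> a \<in> \<Gamma> \<Longrightarrow> \<phi> b \<in> \<Gamma> \<Longrightarrow>
        (\<forall>x\<in>\<Gamma>. infdist x M \<le> d) \<Longrightarrow> t \<ge> 0 \<Longrightarrow>
        (\<forall>x\<in>S t ` \<Gamma>. infdist x M \<le> e) \<and> (\<forall>x\<in>M. infdist x (S t ` \<Gamma>) \<le> e)"
      using stable[OF e] by blast
    have "hausdorff_dist M (S t ` \<Gamma>) \<le> e"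
      if \<Gamma>: "\<Gamma> \<in> curves (m 1) (m k)" "hausdorff_dist M \<Gamma> \<le> d" and t: "t \<ge> 0" for \<Gamma> t
    proof (rule hausdorff[OF \<Gamma>(1) d(2)])
      show "\<forall>x\<in>\<Gamma>. infdist x M \<le> d"
        using infdist_le_one_sided_dist[OF curvesD(1)[OF \<Gamma>(1)] M(2)] \<Gamma>(2)
        unfolding hausdorff_dist_def by (meson max.boundedE order_trans)
    qed (use curvesD[OF \<Gamma>(1)] \<phi> t in auto)
    with d(1) show "\<exists>\<delta>>0. \<forall>\<Gamma>\<in>curves (m 1) (m k). hausdorff_dist M \<Gamma> \<le> \<delta> \<longrightarrow>
        (\<forall>t\<ge>0. hausdorff_dist M (S t ` \<Gamma>) \<le> e)" by blast
  qed
  moreover obtain d where d: "d > 0" "\<And>e. e > 0 \<Longrightarrow> \<exists>T\<ge>0. \<forall>\<Gamma> t. connected \<Gamma> \<longrightarrow> \<phi> a \<in> \<Gamma> \<longrightarrow>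
      \<phi> b \<in> \<Gamma> \<longrightarrow> (\<forall>x\<in>\<Gamma>. infdist x M \<le> d) \<longrightarrow> t > T \<longrightarrow>
      (\<forall>x\<in>S t ` \<Gamma>. infdist x M \<le> e) \<and> (\<forall>x\<in>M. infdist x (S t ` \<Gamma>) \<le> e)"
    using attracting by blast
  define B where "B = {x. infdist x M \<le> d}"
  define U where "U = {x. infdist x M < d}"
  have B: "compact B" unfolding B_def using M d(1) by (intro compact_infdist_le) auto
  have U: "open U" unfolding U_def by (intro open_Collect_less continuous_intros)
  have incl: "M \<subseteq> U" "U \<subseteq> B" using d(1) by (auto simp: U_def B_def)
  have "asymptotically_stable_on S (m 1) (m k) M B"
    unfolding asymptotically_stable_on_def
  proof (intro conjI allI impI)
    fix e :: real assume e: "e > 0"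
    \<comment> \<open>Half of \<open>e\<close> turns the non-strict estimate into the strict
      one.\<close>
    then have "e / 2 > 0" by simp
    from d(2)[OF this] obtain T where T: "T \<ge> 0" "\<And>\<Gamma> t. connected \<Gamma> \<Longrightarrow> \<phi> a \<in> \<Gamma> \<Longrightarrow>
      \<phi> b \<in> \<Gamma> \<Longrightarrow> (\<forall>x\<in>\<Gamma>. infdist x M \<le> d) \<Longrightarrow> t > T \<Longrightarrow>
      (\<forall>x\<in>S t ` \<Gamma>. infdist x M \<le> e / 2) \<and> (\<forall>x\<in>M. infdist x (S t ` \<Gamma>) \<le> e / 2)" by blast
    have "hausdorff_dist M (S t ` \<Gamma>) < e" if "\<Gamma> \<in> curves_in (m 1) (m k) B" "t > T" for \<Gamma> t
    proof -
      have \<Gamma>: "\<Gamma> \<in> curves (m 1) (m k)" "\<forall>x\<in>\<Gamma>. infdist x M \<le> d"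
        using that(1) by (auto simp: curves_in_def B_def)
      have "hausdorff_dist M (S t ` \<Gamma>) \<le> e / 2"
        by (rule hausdorff[OF \<Gamma>(1) T(2)]) (use curvesD[OF \<Gamma>(1)] \<Gamma>(2) \<phi> that(2) in auto)
      with e show ?thesis by simp
    qed
    with T(1) show "\<exists>T\<ge>0. \<forall>\<Gamma>\<in>curves_in (m 1) (m k) B. \<forall>t>T. hausdorff_dist M (S t ` \<Gamma>) < e"
      by blast
  qed (use B incl in auto)
  ultimately show ?thesis using B U incl by blast
qed

end
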